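(* Fix an integer $m\ge1$ and $\epsilon>0$, and let $r=O_{m,\epsilon}\big((\log n)^{O(m^2/\epsilon^2)}\big)$. Given an instance of scheduling $n$ unit-size jobs with precedence constraints on $m$ identical machines, and an integer $T$ for which the $r$-round Sherali-Adams lift of the time-indexed LP (with makespan guess $T$) is feasible, one can find a partial feasible schedule $\sigma:[n]\to[T]\cup\{\mathrm{DISCARDED}\}$ such that $\sigma(j)=\mathrm{DISCARDED}$ for at most $\epsilon T$ jobs $j$.
   Context: Problem: $n$ jobs of unit processing time, a partial order $\prec$ on them, and $m$ identical machines. A partial feasible schedule is a map $\sigma:[n]\to[T]\cup\{\mathrm{DISCARDED}\}$ such that at most $m$ non-discarded jobs are assigned to each time $t\in[T]$, and for any two non-discarded jobs $i\prec j$ we have $\sigma(i)<\sigma(j)$. The time-indexed LP for guess $T$ has variables $y_{jt}$ ($j\in[n]$, $t\in[T]$) with constraints $\sum_{t=1}^T y_{jt}=1$ for all $j$; $\sum_j y_{jt}\le m$ for all $t\le T$; $\sum_{t'\le t}y_{jt'}\ge\sum_{t'\le t+1}y_{it'}$ for all $t\le T$ and $j\prec i$; $y_{jt}\ge0$. The $s$-th round Sherali-Adams lift of an LP in variables $y_1,\dots,y_N\in[0,1]$ has variables $y_S$ for $|S|\le s+1$ ($y_\emptyset=1$) and, for every LP constraint $a^Ty\le b$ (including $0\le y_i\le1$) and all $S,T'\subseteq[N]$ with $|S|+|T'|\le s$, the constraint $\sum_{T''\subseteq T'}(-1)^{|T''|}\big(\sum_i a_i y_{S\cup T''\cup\{i\}}-b\,y_{S\cup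 T''}\big)\le0$. $O_{m,\epsilon}(\cdot)$ hides factors depending only on $m,\epsilon$. *)

theory Defs
  imports Complex_Main "HOL-Library.Landau_Symbols"
begin

(* A pair (a, b) stands for the linear inequality (SUM v:V. a v * y v) <= b. *)
type_synonym 'v lin_ineq = "('v \<Rightarrow> real) \<times> real"

definition box_constraints :: "'v set \<Rightarrow> 'v lin_ineq set" where
  "box_constraints V =
     {(\<lambda>u. - of_bool (u = v), 0) | v. v \<in> V} \<union> {(\<lambda>u. of_bool (u = v), 1) | v. v \<in> V}"

(* Feasible points of the s-round lift.  The lift has a variable y S only for S <= V with
   card S <= s + 1; y is a total function, but the constraints read it at those sets only. *)
definition sherali_adams :: "'v set \<Rightarrow> 'v lin_ineq set \<Rightarrow> nat \<Rightarrow> ('v set \<Rightarrow> real) set" where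
  "sherali_adams V L s =
     {y. y {} = 1 \<and>
         (\<forall>(a, b) \<in> L \<union> box_constraints V. \<forall>S T'. S \<subseteq> V \<longrightarrow> T' \<subseteq> V \<longrightarrow> card S + card T' \<le> s \<longrightarrow>
            (\<Sum>T''\<in>Pow T'. (-1) ^ card T'' *
               ((\<Sum>v\<in>V. a v * y (S \<union> T'' \<union> {v})) - b * y (S \<union> T''))) \<le> 0)}"

(* The precedence relation is the strict order: (j, i) : prec means that j precedes i. *)
definition precedence_order :: "nat \<Rightarrow> nat rel \<Rightarrow> bool" where
  "precedence_order n prec \<longleftrightarrow> prec \<subseteq> {1..n} \<times> {1..n} \<and> irrefl prec \<and> trans prec"

(* The pair (j, t) is the index of the variable y_jt. *)
definition time_indexed_vars :: "nat \<Rightarrow> nat \<Rightarrow> (nat \<times> nat) set" where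
  "time_indexed_vars n T = {1..n} \<times> {1..T}"

(* The first two sets encode the equation SUM t. y_jt = 1.  In the precedence constraints t
   starts at 0, where they say y_i1 <= 0 whenever i has a predecessor.  At t = T the sum up to
   t + 1 stops at T, because there is no variable y_i(T+1). *)
definition time_indexed_lp ::
    "nat \<Rightarrow> nat \<Rightarrow> nat rel \<Rightarrow> nat \<Rightarrow> (nat \<times> nat) lin_ineq set" where
  "time_indexed_lp m n prec T =
     {(\<lambda>(k, u). of_bool (k = j), 1) | j. j \<in> {1..n}} \<union>
     {(\<lambda>(k, u). - of_bool (k = j), -1) | j. j \<in> {1..n}} \<union>
     {(\<lambda>(k, u). of_bool (u = t), real m) | t. t \<in> {1..T}} \<union>
     {(\<lambda>(k, u). of_bool (k = i \<and> u \<le> t + 1) - of_bool (k = j \<and> u \<le> t), 0)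
        | i j t. (j, i) \<in> prec \<and> t \<le> T} \<union>
     {(\<lambda>(k, u). - of_bool (k = j \<and> u = t), 0) | j t. j \<in> {1..n} \<and> t \<in> {1..T}}"

(* None represents DISCARDED. *)
definition partial_feasible_schedule ::
    "nat \<Rightarrow> nat \<Rightarrow> nat rel \<Rightarrow> nat \<Rightarrow> (nat \<Rightarrow> nat option) \<Rightarrow> bool" where
  "partial_feasible_schedule m n prec T \<sigma> \<longleftrightarrow>
     (\<forall>j\<in>{1..n}. \<forall>t. \<sigma> j = Some t \<longrightarrow> t \<in> {1..T}) \<and>
     (\<forall>t\<in>{1..T}. card {j \<in> {1..n}. \<sigma> j = Some t} \<le> m) \<and>
     (\<forall>i j t u. (i, j) \<in> prec \<longrightarrow> \<sigma> i = Some t \<longrightarrow> \<sigma> j = Some u \<longrightarrow> t < u)"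

end

theory Submission
  imports Defs
begin

text \<open>
  Conditioning a Sherali--Adams solution on \<open>y\<^sub>j\<^sub>t = 1\<close> costs one round and cuts the windows
  \<open>[rl i, dl i]\<close> containing the supports of the predecessors and successors of \<open>j\<close> at time \<open>t\<close>.
  A job is owned by the smallest dyadic interval containing its window.  If the owned jobs of an
  interval contain a long chain, then conditioning on the median of the chain moves half of it to a
  child interval, so few rounds make all chains short.  Only windows of jobs comparable with \<open>j\<close>
  are cut, and only weakly (at \<open>t\<close>, not at \<open>t \<plusminus> 1\<close>), so conditioning on a job owned by an interval
  never changes which jobs are owned by strictly larger intervals.  Hence the final owner of every
  job does not depend on where the recursion is cut into pieces of \<open>K\<close> bands of \<open>k\<close> levels, and
  averaging over the \<open>K\<close> possible offsets, one of them discards at most a \<open>1 / K\<close> fraction of the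
  jobs as separating bands.

  Between two cuts, the jobs owned by large (top) intervals are inserted into the slots left free by
  the jobs owned by small (bottom) intervals: an earliest-deadline matching assigns them to bottom
  intervals strictly inside their windows, which by Hall's condition loses few jobs because every top
  job crosses the boundary of a coarse interval; list scheduling inside each bottom interval then
  loses at most \<open>m\<close> jobs per element of a longest chain.
\<close>

section \<open>List scheduling and matching with interval windows\<close>

text \<open>Conditioning on all nodes of the dyadic tree one after the other would cost a number of
  rounds polynomial in \<open>T\<close>. Instead, sibling subtrees start from the same solution and
  condition it independently, so rounds add up only along the depth, at most
  \<open>R = 2 ^ (k * K) * (2 * D * m)\<close> per recursion step. The price is that subtrees end
  with unrelated LP solutions. Their schedules still fit together: windows only shrink, so each
  schedule is valid for the windows of the common ancestor, and these order the jobs of different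
  subtrees. With \<open>K\<close> about \<open>2 * m / \<epsilon>\<close>, the bands cost at most
  \<open>n / K\<close>, half of the budget, since \<open>n \<le> m * T\<close>. With
  \<open>2 ^ k\<close> about \<open>12 * m * (log 2 n + 2) / \<epsilon>\<close>, the other half pays
  for the insertion losses, which grow with the number of levels.
  \<open>D = 2 ^ (k * (2 * K + 1))\<close> is the product of bounds on the number of levels and of
  bottom intervals between two cuts and of the wanted ratio \<open>2 ^ k\<close>. All this is
  polylogarithmic in \<open>n\<close> because a horizon \<open>T \<ge> n\<close> is settled
  directly, so that the tree has about \<open>log 2 n\<close> levels at most.\<close>

lemma linear_extension:
  assumes "finite A" "irrefl r" "trans r"
  shows "\<exists>f::'a \<Rightarrow> nat. inj_on f A \<and> f ` A = {1..card A} \<and> (\<forall>x\<in>A. \<forall>y\<in>A. (x, y) \<in> r \<longrightarrow> f x < f y)"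
  using assms(1)
proof (induction "card A" arbitrary: A)
  case 0
  then show ?case by simp
next
  case (Suc c)
  have "asymp_on A (\<lambda>x y. (x, y) \<in> r)" "transp_on A (\<lambda>x y. (x, y) \<in> r)"
    using assms(2,3) by (auto simp: asymp_on_def transp_on_def irrefl_def dest: transD)
  moreover have "A \<noteq> {}" using Suc.hyps(2) by auto
  ultimately obtain a where a: "a \<in> A" "\<And>x. x \<in> A \<Longrightarrow> (a, x) \<notin> r"
    using Finite_Set.bex_max_element[OF Suc.prems, of "\<lambda>x y. (x, y) \<in> r"] assms(2)
    by (metis irrefl_def)
  have c: "c = card (A - {a})" using Suc a(1) by simp
  obtain f where f: "inj_on f (A - {a})" "f ` (A - {a}) = {1..card (A - {a})}"
      "\<forall>x\<in>A - {a}. \<forall>y\<in>A - {a}. (x, y) \<in> r \<longrightarrow> f x < f y"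
    using Suc.hyps(1)[OF c] Suc.prems by auto
  have le: "f x \<le> c" if "x \<in> A - {a}" for x
    using f(2) c that by (metis atLeastAtMost_iff imageI)
  have "inj_on (f(a := Suc c)) A"
    using f(1) le by (auto simp: inj_on_def) (metis DiffI Suc_n_not_le_n empty_iff insert_iff)+
  moreover have "f(a := Suc c) ` A = {1..card A}"
  proof -
    have "f(a := Suc c) ` A = insert (Suc c) (f ` (A - {a}))" using a(1) by auto
    also have "\<dots> = {1..Suc c}" using f(2) c by auto
    finally show ?thesis using Suc.hyps(2) by simp
  qed
  moreover have "\<forall>x\<in>A. \<forall>y\<in>A. (x, y) \<in> r \<longrightarrow> (f(a := Suc c)) x < (f(a := Suc c)) y"
    using f(3) a(2) le by (auto simp: less_Suc_eq_le)
  ultimately show ?case by blast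
qed

text \<open>Greedy scheduling, slot by slot. Either a slot is filled to its capacity, or all minimal
  jobs fit into it. In the second case at most \<open>m\<close> places are wasted, but the longest
  chain loses an element, so this happens at most \<open>\<Delta>\<close> times while jobs
  remain.\<close>

lemma list_scheduling:
  fixes f :: "nat \<Rightarrow> nat"
  assumes "finite P" "irrefl r" "trans r" "\<And>t. f t \<le> m"
    and "\<And>xs. sorted_wrt (\<lambda>a b. (a, b) \<in> r) xs \<Longrightarrow> set xs \<subseteq> P \<Longrightarrow> length xs \<le> \<Delta>"
  shows "\<exists>\<tau>. (\<forall>j\<in>P. \<forall>t. \<tau> j = Some t \<longrightarrow> t \<in> {lo..<lo + len}) \<and>
           (\<forall>t. card {j \<in> P. \<tau> j = Some t} \<le> f t) \<and>
           (\<forall>i\<in>P. \<forall>j\<in>P. \<forall>t u. (i, j) \<in> r \<longrightarrow> \<tau> i = Some t \<longrightarrow> \<tau> j = Some u \<longrightarrow> t < u) \<and>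
           card {j \<in> P. \<tau> j = None} \<le> (card P - sum f {lo..<lo + len}) + m * \<Delta>"
  using assms(1,5)
proof (induction len arbitrary: lo P \<Delta>)
  case 0
  show ?case by (rule exI[of _ "\<lambda>_. None"]) simp
next
  case (Suc len)
  define M where "M = {x \<in> P. \<forall>y\<in>P. (y, x) \<notin> r}"
  have MP: "M \<subseteq> P" "finite M" using Suc.prems(1) by (auto simp: M_def)
  have sumf: "sum f {lo..<lo + Suc len} = f lo + sum f {Suc lo..<Suc lo + len}"
    by (simp add: sum.atLeast_Suc_lessThan)
  \<comment> \<open>\<open>E\<close> is what slot \<open>lo\<close> receives and
    \<open>\<Delta>'\<close> the chain bound for the rest. A full slot keeps
    \<open>\<Delta>\<close>; a slot that takes all of \<open>M\<close> lowers it by one.\<close>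
  have extend: ?case
    if E: "E \<subseteq> M" "card E \<le> f lo"
      and ch: "\<And>xs. sorted_wrt (\<lambda>a b. (a, b) \<in> r) xs \<Longrightarrow> set xs \<subseteq> P - E \<Longrightarrow> length xs \<le> \<Delta>'"
      and b: "(card P - card E - sum f {Suc lo..<Suc lo + len}) + m * \<Delta>'
              \<le> (card P - sum f {lo..<lo + Suc len}) + m * \<Delta>" for E \<Delta>'
  proof -
    have finE: "finite E" "E \<subseteq> P" using E MP finite_subset by auto
    obtain \<tau> where \<tau>: "\<forall>j\<in>P - E. \<forall>t. \<tau> j = Some t \<longrightarrow> t \<in> {Suc lo..<Suc lo + len}"
        "\<forall>t. card {j \<in> P - E. \<tau> j = Some t} \<le> f t"
        "\<forall>i\<in>P - E. \<forall>j\<in>P - E. \<forall>t u. (i, j) \<in> r \<longrightarrow> \<tau> i = Some t \<longrightarrow> \<tau> j = Some u \<longrightarrow> t < u"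
        "card {j \<in> P - E. \<tau> j = None} \<le> (card (P - E) - sum f {Suc lo..<Suc lo + len}) + m * \<Delta>'"
      using Suc.IH[of "P - E" \<Delta>' "Suc lo"] Suc.prems(1) ch by blast
    define \<rho> where "\<rho> j = (if j \<in> E then Some lo else \<tau> j)" for j
    have 1: "\<forall>j\<in>P. \<forall>t. \<rho> j = Some t \<longrightarrow> t \<in> {lo..<lo + Suc len}"
    proof (intro ballI allI impI)
      fix j t
      assume "j \<in> P" "\<rho> j = Some t"
      then show "t \<in> {lo..<lo + Suc len}"
        using \<tau>(1)[rule_format, of j t] by (cases "j \<in> E") (auto simp: \<rho>_def)
    qed
    have 2: "card {j \<in> P. \<rho> j = Some t} \<le> f t" for t
    proof (cases "t = lo")
      case True
      have "{j \<in> P. \<rho> j = Some t} = E"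
      proof (intro set_eqI iffI)
        fix j
        assume "j \<in> {j \<in> P. \<rho> j = Some t}"
        then show "j \<in> E"
          using True \<tau>(1)[rule_format, of j t] by (cases "j \<in> E") (auto simp: \<rho>_def)
      qed (use True finE(2) in \<open>auto simp: \<rho>_def\<close>)
      then show ?thesis using E(2) True by simp
    next
      case False
      then have "{j \<in> P. \<rho> j = Some t} = {j \<in> P - E. \<tau> j = Some t}" by (auto simp: \<rho>_def)
      then show ?thesis using \<tau>(2) by simp
    qed
    have 3: "t < u" if "i \<in> P" "j \<in> P" "(i, j) \<in> r" "\<rho> i = Some t" "\<rho> j = Some u" for i j t u
    proof -
      have "j \<notin> E" using that E(1) by (auto simp: M_def)
      show ?thesis
      proof (cases "i \<in> E")
        case True
        then have "t = lo" "\<tau> j = Some u" using that \<open>j \<notin> E\<close> by (auto simp: \<rho>_def)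
        then show ?thesis using \<tau>(1)[rule_format, of j u] that(2) \<open>j \<notin> E\<close> by auto
      next
        case False
        then show ?thesis using \<tau>(3) that \<open>j \<notin> E\<close> by (auto simp: \<rho>_def)
      qed
    qed
    have "{j \<in> P. \<rho> j = None} = {j \<in> P - E. \<tau> j = None}" by (auto simp: \<rho>_def)
    then have 4: "card {j \<in> P. \<rho> j = None} \<le> (card P - sum f {lo..<lo + Suc len}) + m * \<Delta>"
      using \<tau>(4) b card_Diff_subset[OF finE] by simp
    show ?thesis using 1 2 3 4 by blast
  qed
  show ?case
  proof (cases "f lo \<le> card M")
    case True
    then obtain E where "E \<subseteq> M" "card E = f lo" by (meson obtain_subset_with_card_n)
    then show ?thesis
      using Suc.prems(2) sumf by (intro extend[of E \<Delta>]) auto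
  next
    case False
    show ?thesis
    proof (cases "P = {}")
      case True
      then show ?thesis by auto
    next
      case nonempty: False
      then obtain p where "p \<in> P" by auto
      then have \<Delta>: "\<Delta> \<ge> 1" using Suc.prems(2)[of "[p]"] by simp
      \<comment> \<open>The head of a chain outside \<open>M\<close> has a predecessor in
        \<open>P\<close>; prepending it gives a longer chain in \<open>P\<close>.\<close>
      have ch: "length xs \<le> \<Delta> - 1"
        if xs: "sorted_wrt (\<lambda>a b. (a, b) \<in> r) xs" "set xs \<subseteq> P - M" for xs
      proof (cases xs)
        case (Cons x ys)
        then obtain y where y: "y \<in> P" "(y, x) \<in> r" using xs(2) by (auto simp: M_def)
        have "sorted_wrt (\<lambda>a b. (a, b) \<in> r) (y # xs)"
          using xs(1) y(2) Cons assms(3) by (auto dest: transD)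
        moreover have "set xs \<subseteq> P" using xs(2) by auto
        ultimately show ?thesis using Suc.prems(2)[of "y # xs"] y(1) by simp
      qed simp
      have "m * (\<Delta> - 1) + f lo \<le> m * \<Delta>"
        using \<Delta> assms(4)[of lo] by (cases \<Delta>) auto
      then show ?thesis
        using False sumf ch by (intro extend[of M "\<Delta> - 1"]) auto
    qed
  qed
qed

lemma smallest_by_key:
  fixes key :: "'a \<Rightarrow> nat"
  assumes "finite S" "inj_on key S" "N \<le> card S"
  shows "\<exists>E\<subseteq>S. card E = N \<and> (\<forall>e\<in>E. \<forall>f\<in>S - E. key e < key f)"
  using assms(3)
proof (induction N)
  case 0
  then show ?case by (intro exI[of _ "{}"]) auto
next
  case (Suc N)
  then obtain E where E: "E \<subseteq> S" "card E = N" "\<forall>e\<in>E. \<forall>f\<in>S - E. key e < key f" by auto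
  have "S - E \<noteq> {}" using E(1,2) Suc.prems assms(1)
    by (metis Diff_eq_empty_iff card_mono finite_subset not_less_eq_eq)
  then obtain x where x: "x \<in> S - E" "\<forall>y\<in>S - E. key x \<le> key y"
    using ex_has_least_nat[of "\<lambda>x. x \<in> S - E" _ key] by (metis ex_in_conv)
  have "card (insert x E) = Suc N" using E(2) x(1) finite_subset[OF E(1) assms(1)] by simp
  moreover have "\<forall>e\<in>insert x E. \<forall>f\<in>S - insert x E. key e < key f"
    using E(3) x assms(2) by (auto simp: inj_on_def) (metis DiffI le_neq_implies_less)
  ultimately show ?case using E(1) x(1) by (intro exI[of _ "insert x E"]) auto
qed

text \<open>Earliest-deadline-first sweep over the positions from \<open>p\<close> on. The last two
  hypotheses are Hall's condition for intervals. For those starting at \<open>p\<close> the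
  condition on \<open>a\<close> is dropped, because jobs released before \<open>p\<close> may still
  be waiting. The last conclusion is what later keeps the matching compatible with
  precedences.\<close>

lemma interval_matching_from:
  fixes a b key :: "'a \<Rightarrow> nat" and cap :: "nat \<Rightarrow> nat"
  assumes "finite P" "inj_on key P" "\<And>i j. i \<in> P \<Longrightarrow> j \<in> P \<Longrightarrow> key i < key j \<Longrightarrow> b i \<le> b j"
    and "\<And>j. j \<in> P \<Longrightarrow> b j < p + len"
    and "\<And>v. card {j \<in> P. b j \<le> v} \<le> sum cap {p..v}"
    and "\<And>u v. u > p \<Longrightarrow> card {j \<in> P. u \<le> a j \<and> b j \<le> v} \<le> sum cap {u..v}"
  shows "\<exists>x. (\<forall>j\<in>P. p \<le> x j \<and> a j \<le> x j \<and> x j \<le> b j) \<and>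
           (\<forall>y. card {j \<in> P. x j = y} \<le> cap y) \<and>
           (\<forall>i\<in>P. \<forall>j\<in>P. a i \<le> a j \<longrightarrow> key i < key j \<longrightarrow> x i \<le> x j)"
  using assms
proof (induction len arbitrary: p P)
  case 0
  have "P = {}"
  proof (rule ccontr)
    assume "P \<noteq> {}"
    then obtain j where j: "j \<in> P" by auto
    then have "b j < p" using "0.prems"(4) by fastforce
    then have "card {i \<in> P. b i \<le> b j} = 0" using "0.prems"(5)[of "b j"] by simp
    then show False using j "0.prems"(1) by auto
  qed
  then show ?case by auto
next
  case (Suc len)
  define S where "S = {j \<in> P. a j \<le> p}"
  have finS: "finite S" "S \<subseteq> P" using Suc.prems(1) by (auto simp: S_def)
  obtain E where E: "E \<subseteq> S" "card E = min (cap p) (card S)" "\<forall>e\<in>E. \<forall>f\<in>S - E. key e < key f"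
    using smallest_by_key[OF finS(1) inj_on_subset[OF Suc.prems(2) finS(2)], of "min (cap p) (card S)"]
    by auto
  have finE: "finite E" using E(1) finS(1) finite_subset by auto
  have sumcap: "sum cap {p..v} = cap p + sum cap {Suc p..v}" if "p \<le> v" for v
    using that by (simp add: sum.atLeast_Suc_atMost)
  have bp: "p \<le> b j" if "j \<in> P" for j
  proof (rule ccontr)
    assume "\<not> p \<le> b j"
    then have "card {i \<in> P. b i \<le> b j} = 0" using Suc.prems(5)[of "b j"] by simp
    then show False using that Suc.prems(1) by auto
  qed
  \<comment> \<open>Hall's condition survives the removal of \<open>E\<close>. If every available
    job left over has its deadline after \<open>v\<close>, the jobs that count are released after
    \<open>p\<close>. Otherwise position \<open>p\<close> is full and, by the order of the keys, all
    of \<open>E\<close> has deadlines up to \<open>v\<close>, so both sides drop by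
    \<open>cap p\<close>.\<close>
  have first: "card {j \<in> P - E. b j \<le> v} \<le> sum cap {Suc p..v}" for v
  proof (cases "p \<le> v")
    case False
    then have *: "{j \<in> P - E. b j \<le> v} = {}" using bp by fastforce
    show ?thesis unfolding * by simp
  next
    case pv: True
    have late: "card {j \<in> P. Suc p \<le> a j \<and> b j \<le> v} \<le> sum cap {Suc p..v}"
      using Suc.prems(6)[of "Suc p" v] by simp
    have fin2: "finite {j \<in> P. Suc p \<le> a j \<and> b j \<le> v}" using Suc.prems(1) by simp
    show ?thesis
    proof (cases "\<forall>f\<in>S - E. b f > v")
      case True
      have "{j \<in> P - E. b j \<le> v} \<subseteq> {j \<in> P. Suc p \<le> a j \<and> b j \<le> v}"
      proof
        fix j
        assume "j \<in> {j \<in> P - E. b j \<le> v}"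
        then have j: "j \<in> P" "j \<notin> E" "b j \<le> v" by auto
        then have "j \<notin> S" using True by force
        then show "j \<in> {j \<in> P. Suc p \<le> a j \<and> b j \<le> v}" using j by (auto simp: S_def)
      qed
      then show ?thesis using late card_mono[OF fin2] le_trans by blast
    next
      case False
      then obtain f where f: "f \<in> S - E" "b f \<le> v" by force
      then have "card E < card S" using E(1) finS(1) by (intro psubset_card_mono) auto
      then have "card E = cap p" using E(2) by auto
      have be: "b e \<le> v" if "e \<in> E" for e
        using that E f Suc.prems(3)[of e f] finS(2) by fastforce
      have "card {j \<in> P - E. b j \<le> v} = card {j \<in> P. b j \<le> v} - cap p"
      proof -
        have "E \<subseteq> {j \<in> P. b j \<le> v}" using be E(1) finS(2) by auto
        moreover have "{j \<in> P - E. b j \<le> v} = {j \<in> P. b j \<le> v} - E" by auto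
        ultimately show ?thesis using card_Diff_subset[OF finE] \<open>card E = cap p\<close> by simp
      qed
      then show ?thesis using Suc.prems(5)[of v] sumcap[OF pv] by simp
    qed
  qed
  have second: "card {j \<in> P - E. u \<le> a j \<and> b j \<le> v} \<le> sum cap {u..v}" if "u > Suc p" for u v
  proof -
    have "card {j \<in> P - E. u \<le> a j \<and> b j \<le> v} \<le> card {j \<in> P. u \<le> a j \<and> b j \<le> v}"
      using Suc.prems(1) by (intro card_mono) auto
    then show ?thesis using Suc.prems(6)[of u v] that by simp
  qed
  obtain x where x: "\<forall>j\<in>P - E. Suc p \<le> x j \<and> a j \<le> x j \<and> x j \<le> b j"
      "\<forall>y. card {j \<in> P - E. x j = y} \<le> cap y"
      "\<forall>i\<in>P - E. \<forall>j\<in>P - E. a i \<le> a j \<longrightarrow> key i < key j \<longrightarrow> x i \<le> x j"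
  proof -
    have "inj_on key (P - E)" using Suc.prems(2) by (rule inj_on_subset) auto
    then have "\<exists>x. (\<forall>j\<in>P - E. Suc p \<le> x j \<and> a j \<le> x j \<and> x j \<le> b j) \<and>
        (\<forall>y. card {j \<in> P - E. x j = y} \<le> cap y) \<and>
        (\<forall>i\<in>P - E. \<forall>j\<in>P - E. a i \<le> a j \<longrightarrow> key i < key j \<longrightarrow> x i \<le> x j)"
      using Suc.prems(1,3,4) first second by (intro Suc.IH) auto
    then show ?thesis using that by blast
  qed
  define z where "z j = (if j \<in> E then p else x j)" for j
  have 1: "p \<le> z j \<and> a j \<le> z j \<and> z j \<le> b j" if "j \<in> P" for j
    using x(1) that E(1) bp by (auto simp: z_def S_def Suc_le_eq less_imp_le)
  have 2: "card {j \<in> P. z j = y} \<le> cap y" for y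
  proof (cases "y = p")
    case True
    then have "{j \<in> P. z j = y} = E"
    proof (intro set_eqI iffI)
      fix j
      assume "j \<in> {j \<in> P. z j = y}"
      then show "j \<in> E" using x(1)[rule_format, of j] True by (cases "j \<in> E") (auto simp: z_def)
    qed (use True E(1) finS(2) in \<open>auto simp: z_def\<close>)
    then show ?thesis using E(2) True by simp
  next
    case False
    then have "{j \<in> P. z j = y} = {j \<in> P - E. x j = y}" by (auto simp: z_def)
    then show ?thesis using x(2) by simp
  qed
  have 3: "z i \<le> z j" if "i \<in> P" "j \<in> P" "a i \<le> a j" "key i < key j" for i j
  proof (cases "j \<in> E")
    case True
    \<comment> \<open>A job released no later than \<open>j\<close> and with a smaller key was
      available at \<open>p\<close> too, and the choice by key took it before
      \<open>j\<close>.\<close>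
    then have "i \<in> S" using E(1) that by (auto simp: S_def)
    then have "i \<in> E" using E(3) True that(4) by (meson DiffI not_less_iff_gr_or_eq)
    then show ?thesis by (simp add: z_def True)
  next
    case False
    then show ?thesis using x(1,3) that 1[of j] by (cases "i \<in> E") (auto simp: z_def)
  qed
  show ?case using 1 2 3 by blast
qed

section \<open>Conditioning Sherali--Adams solutions\<close>

lemma sherali_adams_constraint:
  assumes "y \<in> sherali_adams V L s" "(a, b) \<in> L \<union> box_constraints V" "S \<subseteq> V" "T' \<subseteq> V"
    "card S + card T' \<le> s"
  shows "(\<Sum>T''\<in>Pow T'. (-1) ^ card T'' *
           ((\<Sum>v\<in>V. a v * y (S \<union> T'' \<union> {v})) - b * y (S \<union> T''))) \<le> 0"
proof -
  have "\<forall>(a, b) \<in> L \<union> box_constraints V. \<forall>S T'. S \<subseteq> V \<longrightarrow> T' \<subseteq> V \<longrightarrow> card S + card T' \<le> s \<longrightarrow>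
      (\<Sum>T''\<in>Pow T'. (-1) ^ card T'' *
        ((\<Sum>v\<in>V. a v * y (S \<union> T'' \<union> {v})) - b * y (S \<union> T''))) \<le> 0"
    by (rule conjunct2[OF CollectD[OF assms(1)[unfolded sherali_adams_def]]])
  from bspec[OF this assms(2), unfolded prod.case] show ?thesis using assms(3-5) by blast
qed

lemma sherali_adams_mono:
  assumes "s \<le> s'" shows "sherali_adams V L s' \<subseteq> sherali_adams V L s"
proof
  fix y
  assume y: "y \<in> sherali_adams V L s'"
  have "y {} = 1" using y by (simp add: sherali_adams_def)
  moreover have "(\<Sum>T''\<in>Pow T'. (-1) ^ card T'' *
      ((\<Sum>v\<in>V. a v * y (S \<union> T'' \<union> {v})) - b * y (S \<union> T''))) \<le> 0"
    if "(a, b) \<in> L \<union> box_constraints V" "S \<subseteq> V" "T' \<subseteq> V" "card S + card T' \<le> s" for a b S T'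
    using sherali_adams_constraint[OF y that(1-3)] that(4) assms by simp
  ultimately show "y \<in> sherali_adams V L s"
    unfolding sherali_adams_def by blast
qed

lemma sherali_adams_lp:
  assumes "y \<in> sherali_adams V L s" "(a, b) \<in> L"
  shows "(\<Sum>v\<in>V. a v * y {v}) \<le> b"
proof -
  have "y {} = 1" using assms(1) by (simp add: sherali_adams_def)
  then show ?thesis
    using sherali_adams_constraint[OF assms(1), of a b "{}" "{}"] assms(2) by simp
qed

lemma sherali_adams_insert_nonneg:
  assumes "y \<in> sherali_adams V L s" "finite V" "S \<subseteq> V" "card S \<le> s" "v \<in> V"
  shows "0 \<le> y (insert v S)"
proof -
  have "(\<lambda>u. - of_bool (u = v), 0) \<in> L \<union> box_constraints V"
    using assms(5) by (auto simp: box_constraints_def)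
  from sherali_adams_constraint[OF assms(1) this assms(3), of "{}"]
  have "(\<Sum>u\<in>V. - of_bool (u = v) * y (insert u S)) \<le> 0" using assms(4) by simp
  moreover have "(\<Sum>u\<in>V. - of_bool (u = v) * y (insert u S)) = - y (insert v S)"
  proof -
    have "(\<Sum>u\<in>V. - of_bool (u = v) * y (insert u S)) = (\<Sum>u\<in>V. if u = v then - y (insert v S) else 0)"
      by (intro sum.cong) auto
    then show ?thesis using assms(2,5) by simp
  qed
  ultimately show ?thesis by simp
qed

text \<open>Together with \<open>sherali_adams_insert_nonneg\<close>, this makes pair variables
  vanish with their singletons, so conditioning never enlarges a support.\<close>

lemma sherali_adams_insert_le:
  assumes "y \<in> sherali_adams V L s" "finite V" "S \<subseteq> V" "card S \<le> s" "v \<in> V"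
  shows "y (insert v S) \<le> y S"
proof -
  have "(\<lambda>u. of_bool (u = v), 1) \<in> L \<union> box_constraints V"
    using assms(5) by (auto simp: box_constraints_def)
  from sherali_adams_constraint[OF assms(1) this assms(3), of "{}"]
  have "(\<Sum>u\<in>V. of_bool (u = v) * y (insert u S)) - y S \<le> 0" using assms(4) by simp
  moreover have "(\<Sum>u\<in>V. of_bool (u = v) * y (insert u S)) = y (insert v S)"
  proof -
    have "(\<Sum>u\<in>V. of_bool (u = v) * y (insert u S)) = (\<Sum>u\<in>V. if u = v then y (insert v S) else 0)"
      by (intro sum.cong) auto
    then show ?thesis using assms(2,5) by simp
  qed
  ultimately show ?thesis by simp
qed

text \<open>The constraint of the new point for \<open>(S, T')\<close> is that of \<open>y\<close>
  for \<open>(insert v S, T')\<close> divided by \<open>y {v}\<close>. The enlarged first set is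
  what costs the round.\<close>

lemma sherali_adams_condition:
  assumes y: "y \<in> sherali_adams V L (Suc s)" and v: "v \<in> V" "y {v} > 0" and fin: "finite V"
  shows "(\<lambda>S. y (insert v S) / y {v}) \<in> sherali_adams V L s"
  unfolding sherali_adams_def
proof (intro CollectI conjI ballI, goal_cases)
  case 1
  then show ?case using v by simp
next
  case (2 c)
  obtain a b where c: "c = (a, b)" by force
  show ?case unfolding c prod.case
  proof (intro allI impI)
    fix S T'
    assume ST: "S \<subseteq> V" "T' \<subseteq> V" "card S + card T' \<le> s"
    have "card (insert v S) \<le> Suc (card S)"
      using finite_subset[OF ST(1) fin] by (simp add: card_insert_if)
    then have "(\<Sum>T''\<in>Pow T'. (-1) ^ card T'' *
           ((\<Sum>u\<in>V. a u * y (insert v S \<union> T'' \<union> {u})) - b * y (insert v S \<union> T''))) \<le> 0"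
      using sherali_adams_constraint[OF y, of a b "insert v S" T'] 2 c ST v by simp
    then have "(\<Sum>T''\<in>Pow T'. (-1) ^ card T'' *
           ((\<Sum>u\<in>V. a u * y (insert v S \<union> T'' \<union> {u})) - b * y (insert v S \<union> T''))) / y {v} \<le> 0"
      using v(2) by (simp add: divide_le_0_iff)
    then show "(\<Sum>T''\<in>Pow T'. (-1) ^ card T'' *
           ((\<Sum>u\<in>V. a u * (y (insert v (S \<union> T'' \<union> {u})) / y {v})) -
             b * (y (insert v (S \<union> T'')) / y {v}))) \<le> 0"
      by (simp only: Un_insert_left sum_divide_distrib times_divide_eq_right[symmetric]
          diff_divide_distrib)
  qed
qed

text \<open>Forgets everything about the LP solution except windows around its supports. The
  scheduling argument only handles window ends and uses the LP through conditioning, Hall's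
  condition and the separation of one-point windows.\<close>

definition window_feasible ::
    "nat \<Rightarrow> nat \<Rightarrow> nat rel \<Rightarrow> nat \<Rightarrow> nat \<Rightarrow> (nat \<Rightarrow> nat) \<Rightarrow> (nat \<Rightarrow> nat) \<Rightarrow> bool" where
  "window_feasible m n prec T s rl dl \<longleftrightarrow>
     (\<exists>y \<in> sherali_adams (time_indexed_vars n T) (time_indexed_lp m n prec T) s.
        \<forall>j\<in>{1..n}. \<forall>t\<in>{1..T}. y {(j, t)} \<noteq> 0 \<longrightarrow> rl j \<le> t \<and> t \<le> dl j)"

lemma finite_time_indexed_vars: "finite (time_indexed_vars n T)"
  by (simp add: time_indexed_vars_def)

lemma sum_time_indexed_vars:
  "(\<Sum>v\<in>time_indexed_vars n T. f v) = (\<Sum>k=1..n. \<Sum>u=1..T. f (k, u))"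
  unfolding time_indexed_vars_def by (subst sum.cartesian_product) simp

lemma window_feasible_Suc:
  "window_feasible m n prec T (Suc s) rl dl \<Longrightarrow> window_feasible m n prec T s rl dl"
  unfolding window_feasible_def
  using sherali_adams_mono[of s "Suc s" "time_indexed_vars n T" "time_indexed_lp m n prec T"] by auto

section \<open>What the LP constraints say about the singleton variables\<close>

context
  fixes m n T s :: nat and prec :: "nat rel" and y :: "(nat \<times> nat) set \<Rightarrow> real"
  assumes y: "y \<in> sherali_adams (time_indexed_vars n T) (time_indexed_lp m n prec T) s"
begin

lemma vars_nonneg: "j \<in> {1..n} \<Longrightarrow> t \<in> {1..T} \<Longrightarrow> 0 \<le> y {(j, t)}"
  using sherali_adams_insert_nonneg[OF y finite_time_indexed_vars, of "{}" "(j, t)"]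
  by (simp add: time_indexed_vars_def)

lemma vars_sum_eq_1:
  assumes j: "j \<in> {1..n}"
  shows "(\<Sum>t=1..T. y {(j, t)}) = 1"
proof -
  have eq: "(\<Sum>v\<in>time_indexed_vars n T. (case v of (k, u) \<Rightarrow> of_bool (k = j)) * y {v})
      = (\<Sum>t=1..T. y {(j, t)})"
  proof -
    have "(\<Sum>v\<in>time_indexed_vars n T. (case v of (k, u) \<Rightarrow> of_bool (k = j)) * y {v})
        = (\<Sum>k=1..n. \<Sum>t=1..T. of_bool (k = j) * y {(k, t)})"
      unfolding sum_time_indexed_vars by (simp only: prod.case)
    also have "\<dots> = (\<Sum>k=1..n. if k = j then \<Sum>t=1..T. y {(k, t)} else 0)"
      by (intro sum.cong) auto
    finally show ?thesis using j by simp
  qed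
  have "(\<Sum>v\<in>time_indexed_vars n T. (case v of (k, u) \<Rightarrow> of_bool (k = j)) * y {v}) \<le> 1"
    by (rule sherali_adams_lp[OF y]) (use j in \<open>auto simp: time_indexed_lp_def\<close>)
  moreover have "(\<Sum>v\<in>time_indexed_vars n T. (case v of (k, u) \<Rightarrow> - of_bool (k = j)) * y {v}) \<le> -1"
    by (rule sherali_adams_lp[OF y]) (use j in \<open>auto simp: time_indexed_lp_def\<close>)
  moreover have "(\<Sum>v\<in>time_indexed_vars n T. (case v of (k, u) \<Rightarrow> - of_bool (k = j)) * y {v})
      = - (\<Sum>v\<in>time_indexed_vars n T. (case v of (k, u) \<Rightarrow> of_bool (k = j)) * y {v})"
    by (subst sum_negf[symmetric]) (intro sum.cong, auto)
  ultimately show ?thesis using eq by simp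
qed

lemma vars_capacity:
  assumes t: "t \<in> {1..T}"
  shows "(\<Sum>j=1..n. y {(j, t)}) \<le> real m"
proof -
  have "(\<Sum>v\<in>time_indexed_vars n T. (case v of (k, u) \<Rightarrow> of_bool (u = t)) * y {v}) \<le> real m"
    by (rule sherali_adams_lp[OF y]) (use t in \<open>auto simp: time_indexed_lp_def\<close>)
  moreover have "(\<Sum>v\<in>time_indexed_vars n T. (case v of (k, u) \<Rightarrow> of_bool (u = t)) * y {v})
      = (\<Sum>k=1..n. \<Sum>u=1..T. of_bool (u = t) * y {(k, u)})"
    unfolding sum_time_indexed_vars by (simp only: prod.case)
  moreover have "\<dots> = (\<Sum>k=1..n. y {(k, t)})"
  proof (rule sum.cong[OF refl])
    fix k
    have "(\<Sum>u=1..T. of_bool (u = t) * y {(k, u)}) = (\<Sum>u=1..T. if u = t then y {(k, t)} else 0)"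
      by (intro sum.cong) auto
    then show "(\<Sum>u=1..T. of_bool (u = t) * y {(k, u)}) = y {(k, t)}" using t by simp
  qed
  ultimately show ?thesis by simp
qed

lemma vars_precedence:
  assumes "(j, i) \<in> prec" "t \<le> T" "i \<in> {1..n}" "j \<in> {1..n}"
  shows "(\<Sum>u\<in>{1..T} \<inter> {..t + 1}. y {(i, u)}) \<le> (\<Sum>u\<in>{1..T} \<inter> {..t}. y {(j, u)})"
proof -
  have "(\<Sum>v\<in>time_indexed_vars n T.
      (case v of (k, u) \<Rightarrow> of_bool (k = i \<and> u \<le> t + 1) - of_bool (k = j \<and> u \<le> t)) * y {v}) \<le> 0"
    by (rule sherali_adams_lp[OF y]) (use assms in \<open>auto simp: time_indexed_lp_def\<close>)
  moreover have "(\<Sum>v\<in>time_indexed_vars n T.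
      (case v of (k, u) \<Rightarrow> of_bool (k = i \<and> u \<le> t + 1) - of_bool (k = j \<and> u \<le> t)) * y {v})
      = (\<Sum>k=1..n. \<Sum>u=1..T. (of_bool (k = i \<and> u \<le> t + 1) - of_bool (k = j \<and> u \<le> t)) * y {(k, u)})"
    unfolding sum_time_indexed_vars by (simp only: prod.case)
  moreover have "\<dots> = (\<Sum>k=1..n. \<Sum>u=1..T. of_bool (k = i \<and> u \<le> t + 1) * y {(k, u)})
      - (\<Sum>k=1..n. \<Sum>u=1..T. of_bool (k = j \<and> u \<le> t) * y {(k, u)})"
    by (simp add: left_diff_distrib sum_subtractf)
  moreover have "(\<Sum>k=1..n. \<Sum>u=1..T. of_bool (k = l \<and> u \<le> w) * y {(k, u)})
      = (\<Sum>u\<in>{1..T} \<inter> {..w}. y {(l, u)})" if "l \<in> {1..n}" for l w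
  proof -
    have "(\<Sum>k=1..n. \<Sum>u=1..T. of_bool (k = l \<and> u \<le> w) * y {(k, u)})
       = (\<Sum>k=1..n. if k = l then \<Sum>u=1..T. of_bool (u \<le> w) * y {(k, u)} else 0)"
      by (intro sum.cong) auto
    also have "\<dots> = (\<Sum>u=1..T. of_bool (u \<le> w) * y {(l, u)})" using that by simp
    also have "\<dots> = (\<Sum>u\<in>{1..T} \<inter> {..w}. y {(l, u)})"
      unfolding sum.inter_restrict[OF finite_atLeastAtMost] by (intro sum.cong) auto
    finally show ?thesis .
  qed
  ultimately show ?thesis using assms by simp
qed

lemma vars_zero_if_one:
  assumes "j \<in> {1..n}" "t \<in> {1..T}" "u \<in> {1..T}" "y {(j, t)} = 1" "u \<noteq> t"
  shows "y {(j, u)} = 0"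
proof -
  have "1 = y {(j, t)} + (\<Sum>u\<in>{1..T} - {t}. y {(j, u)})"
    using vars_sum_eq_1[OF assms(1)] assms(2) by (simp add: sum.remove)
  then have "(\<Sum>u\<in>{1..T} - {t}. y {(j, u)}) = 0" using assms(4) by simp
  then have "\<forall>u\<in>{1..T} - {t}. y {(j, u)} = 0"
    using vars_nonneg[OF assms(1)] by (subst (asm) sum_nonneg_eq_0_iff) auto
  then show ?thesis using assms(3,5) by simp
qed

text \<open>The precedence constraint at \<open>t - 1\<close> bounds the mass of \<open>j\<close> up
  to \<open>t\<close> by the mass of \<open>i\<close> up to \<open>t - 1\<close>. If
  \<open>i\<close> sits at \<open>t\<close>, the bound is 0; if \<open>j\<close> sits at
  \<open>t\<close>, all mass of \<open>i\<close> must come earlier. For \<open>t = 1\<close> this is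
  the constraint at time 0.\<close>

lemma vars_one_precedence:
  assumes prec: "(i, j) \<in> prec" and ij: "i \<in> {1..n}" "j \<in> {1..n}" and t: "t \<in> {1..T}"
    and u: "u \<in> {1..T}"
  shows "y {(i, t)} = 1 \<Longrightarrow> y {(j, u)} \<noteq> 0 \<Longrightarrow> t < u"
    and "y {(j, t)} = 1 \<Longrightarrow> y {(i, u)} \<noteq> 0 \<Longrightarrow> u < t"
proof -
  have le: "(\<Sum>u\<in>{1..T} \<inter> {..t}. y {(j, u)}) \<le> (\<Sum>u\<in>{1..T} \<inter> {..t - 1}. y {(i, u)})"
  proof -
    have "t - 1 \<le> T" "t - 1 + 1 = t" using t by auto
    then show ?thesis using vars_precedence[OF prec _ ij(2,1), of "t - 1"] by simp
  qed
  {
    assume 1: "y {(i, t)} = 1"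
    have "(\<Sum>u\<in>{1..T} \<inter> {..t - 1}. y {(i, u)}) = 0"
      using vars_zero_if_one[OF ij(1) t _ 1] t by (intro sum.neutral) auto
    then have "(\<Sum>u\<in>{1..T} \<inter> {..t}. y {(j, u)}) = 0"
      using le vars_nonneg[OF ij(2)] by (intro antisym[OF _ sum_nonneg]) auto
    then have "\<forall>u\<in>{1..T} \<inter> {..t}. y {(j, u)} = 0"
      using vars_nonneg[OF ij(2)] by (subst (asm) sum_nonneg_eq_0_iff) auto
    then show "y {(j, u)} \<noteq> 0 \<Longrightarrow> t < u" using u by (meson IntI atMost_iff not_le)
  next
    assume 1: "y {(j, t)} = 1"
    have "1 \<le> (\<Sum>u\<in>{1..T} \<inter> {..t}. y {(j, u)})"
      using member_le_sum[of t "{1..T} \<inter> {..t}" "\<lambda>u. y {(j, u)}"] t vars_nonneg[OF ij(2)] 1 by auto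
    moreover have "(\<Sum>u\<in>{1..T} \<inter> {..t - 1}. y {(i, u)}) +
        (\<Sum>u\<in>{1..T} - {..t - 1}. y {(i, u)}) = 1"
      using vars_sum_eq_1[OF ij(1)] sum.Int_Diff[of "{1..T}" "\<lambda>u. y {(i, u)}" "{..t - 1}"] by simp
    ultimately have "(\<Sum>u\<in>{1..T} - {..t - 1}. y {(i, u)}) = 0"
      using le vars_nonneg[OF ij(1)] by (intro antisym[OF _ sum_nonneg]) auto
    then have "\<forall>u\<in>{1..T} - {..t - 1}. y {(i, u)} = 0"
      using vars_nonneg[OF ij(1)] by (subst (asm) sum_nonneg_eq_0_iff) auto
    then show "y {(i, u)} \<noteq> 0 \<Longrightarrow> u < t" using u t by force
  }
qed

end

lemma window_feasible_condition:
  assumes W: "window_feasible m n prec T (Suc s) rl dl" and j: "j \<in> {1..n}"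
    and prec: "precedence_order n prec"
  shows "\<exists>t. rl j \<le> t \<and> t \<le> dl j \<and> window_feasible m n prec T s
     (\<lambda>i. if i = j then t else if (j, i) \<in> prec then max (rl i) t else rl i)
     (\<lambda>i. if i = j then t else if (i, j) \<in> prec then min (dl i) t else dl i)"
proof -
  let ?V = "time_indexed_vars n T" and ?L = "time_indexed_lp m n prec T"
  obtain y where y: "y \<in> sherali_adams ?V ?L (Suc s)"
    and supp: "\<And>j t. j \<in> {1..n} \<Longrightarrow> t \<in> {1..T} \<Longrightarrow> y {(j, t)} \<noteq> 0 \<Longrightarrow> rl j \<le> t \<and> t \<le> dl j"
    using W unfolding window_feasible_def by blast
  have "\<exists>t\<in>{1..T}. y {(j, t)} \<noteq> 0"
    using vars_sum_eq_1[OF y j] by (metis (mono_tags, lifting) sum.neutral zero_neq_one)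
  then obtain t where t: "t \<in> {1..T}" "y {(j, t)} \<noteq> 0" by blast
  then have pos: "y {(j, t)} > 0" using vars_nonneg[OF y j t(1)] by simp
  define z where "z S = y (insert (j, t) S) / y {(j, t)}" for S
  have jt: "(j, t) \<in> ?V" using j t by (simp add: time_indexed_vars_def)
  have z: "z \<in> sherali_adams ?V ?L s"
    unfolding z_def using sherali_adams_condition[OF y jt pos finite_time_indexed_vars] .
  have zone: "z {(j, t)} = 1" using pos by (simp add: z_def)
  have zsupp: "y {(i, u)} \<noteq> 0" if "i \<in> {1..n}" "u \<in> {1..T}" "z {(i, u)} \<noteq> 0" for i u
  proof
    assume 0: "y {(i, u)} = 0"
    have iu: "(i, u) \<in> ?V" using that by (simp add: time_indexed_vars_def)
    have "y (insert (j, t) {(i, u)}) \<le> y {(i, u)}"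
      using sherali_adams_insert_le[OF y finite_time_indexed_vars _ _ jt, of "{(i, u)}"] iu by simp
    moreover have "0 \<le> y (insert (j, t) {(i, u)})"
      using sherali_adams_insert_nonneg[OF y finite_time_indexed_vars _ _ jt, of "{(i, u)}"] iu by simp
    ultimately show False using 0 that(3) by (simp add: z_def)
  qed
  have irr: "(j, j) \<notin> prec" using prec by (auto simp: precedence_order_def irrefl_def)
  have "window_feasible m n prec T s
     (\<lambda>i. if i = j then t else if (j, i) \<in> prec then max (rl i) t else rl i)
     (\<lambda>i. if i = j then t else if (i, j) \<in> prec then min (dl i) t else dl i)"
    unfolding window_feasible_def
  proof (rule bexI[OF _ z], intro ballI impI)
    fix i u
    assume i: "i \<in> {1..n}" "u \<in> {1..T}" "z {(i, u)} \<noteq> 0"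
    have "rl i \<le> u" "u \<le> dl i" using supp zsupp i by auto
    moreover have "u = t" if "i = j" using vars_zero_if_one[OF z j t(1) i(2) zone] that i(3) by blast
    \<comment> \<open>The strict inequality is weakened on purpose: \<open>t\<close> lies in the
      window of \<open>j\<close> and hence in its dyadic interval, whereas \<open>t + 1\<close> or
      \<open>t - 1\<close> may fall outside it.\<close>
    moreover have "t < u" if "(j, i) \<in> prec"
      using vars_one_precedence(1)[OF z that j i(1) t(1) i(2) zone i(3)] .
    moreover have "u < t" if "(i, j) \<in> prec"
      using vars_one_precedence(2)[OF z that i(1) j t(1) i(2) zone i(3)] .
    ultimately show "(if i = j then t else if (j, i) \<in> prec then max (rl i) t else rl i) \<le> u \<and>
        u \<le> (if i = j then t else if (i, j) \<in> prec then min (dl i) t else dl i)"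
      by (auto simp: less_imp_le)
  qed
  then show ?thesis using supp[OF j t] by blast
qed

text \<open>Double counting: each such job has its whole unit of LP mass inside
  \<open>{a..b}\<close>, and a time carries mass at most \<open>m\<close>.\<close>

lemma window_feasible_hall:
  assumes W: "window_feasible m n prec T s rl dl"
  shows "card {j \<in> {1..n}. a \<le> rl j \<and> dl j \<le> b} \<le> m * (b + 1 - a)"
proof -
  obtain y where y: "y \<in> sherali_adams (time_indexed_vars n T) (time_indexed_lp m n prec T) s"
    and supp: "\<And>j t. j \<in> {1..n} \<Longrightarrow> t \<in> {1..T} \<Longrightarrow> y {(j, t)} \<noteq> 0 \<Longrightarrow> rl j \<le> t \<and> t \<le> dl j"
    using W unfolding window_feasible_def by blast
  let ?X = "{j \<in> {1..n}. a \<le> rl j \<and> dl j \<le> b}" and ?I = "{1..T} \<inter> {a..b}"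
  have "real (card ?X) = (\<Sum>j\<in>?X. \<Sum>t=1..T. y {(j, t)})"
    using vars_sum_eq_1[OF y] by simp
  also have "\<dots> = (\<Sum>j\<in>?X. \<Sum>t\<in>?I. y {(j, t)})"
  proof (rule sum.cong[OF refl])
    fix j
    assume j: "j \<in> ?X"
    have "y {(j, t)} = 0" if "t \<in> {1..T} - ?I" for t using supp[of j t] j that by fastforce
    then show "(\<Sum>t=1..T. y {(j, t)}) = (\<Sum>t\<in>?I. y {(j, t)})"
      by (intro sum.mono_neutral_right) auto
  qed
  also have "\<dots> \<le> (\<Sum>j=1..n. \<Sum>t\<in>?I. y {(j, t)})"
    using vars_nonneg[OF y] by (intro sum_mono2 sum_nonneg) auto
  also have "\<dots> = (\<Sum>t\<in>?I. \<Sum>j=1..n. y {(j, t)})" by (rule sum.swap)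
  also have "\<dots> \<le> (\<Sum>t\<in>?I. real m)" using vars_capacity[OF y] by (intro sum_mono) auto
  also have "\<dots> \<le> real m * real (b + 1 - a)"
  proof -
    have "card ?I \<le> card {a..b}" by (intro card_mono) auto
    then show ?thesis by (simp add: mult.commute mult_left_mono)
  qed
  finally show ?thesis by (metis of_nat_le_iff of_nat_mult)
qed

text \<open>Weak cuts allow comparable jobs to have equal window ends. For one-point windows the LP
  itself excludes this, since all mass of both jobs would be at the same time.\<close>

lemma window_feasible_singletons:
  assumes W: "window_feasible m n prec T s rl dl" and prec: "(i, j) \<in> prec" "i \<in> {1..n}" "j \<in> {1..n}"
    and "rl i = dl i" "rl j = dl j"
  shows "rl i \<noteq> rl j"
proof
  assume eq: "rl i = rl j"
  obtain y where y: "y \<in> sherali_adams (time_indexed_vars n T) (time_indexed_lp m n prec T) s"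
    and supp: "\<And>j t. j \<in> {1..n} \<Longrightarrow> t \<in> {1..T} \<Longrightarrow> y {(j, t)} \<noteq> 0 \<Longrightarrow> rl j \<le> t \<and> t \<le> dl j"
    using W unfolding window_feasible_def by blast
  have one: "rl k \<in> {1..T} \<and> y {(k, rl k)} = 1" if k: "k \<in> {1..n}" "rl k = dl k" for k
  proof -
    have z: "y {(k, t)} = 0" if "t \<in> {1..T}" "t \<noteq> rl k" for t
      using supp[of k t] k that by fastforce
    have *: "(\<Sum>t=1..T. y {(k, t)}) = (\<Sum>t=1..T. if t = rl k then y {(k, rl k)} else 0)"
      using z by (intro sum.cong) auto
    show ?thesis using vars_sum_eq_1[OF y k(1)] unfolding * by (auto split: if_splits)
  qed
  show False
    using vars_one_precedence(1)[OF y prec, of "rl i" "rl i"] one[of i] one[of j] assms eq by simp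
qed

section \<open>Making chains short\<close>

lemma div_power_eq_iff:
  fixes x q a :: nat
  shows "x div 2 ^ a = q \<longleftrightarrow> q * 2 ^ a \<le> x \<and> x < (q + 1) * 2 ^ a"
proof
  assume "x div 2 ^ a = q"
  then show "q * 2 ^ a \<le> x \<and> x < (q + 1) * 2 ^ a"
    using div_times_less_eq_dividend[of x "2 ^ a"] dividend_less_div_times[of "2 ^ a" x] by auto
next
  assume "q * 2 ^ a \<le> x \<and> x < (q + 1) * 2 ^ a"
  then show "x div 2 ^ a = q" by (intro div_nat_eqI) (auto simp: mult.commute)
qed

lemma div_power_coarsen:
  fixes x y :: nat
  assumes "x div 2 ^ a = y div 2 ^ a" "a \<le> b"
  shows "x div 2 ^ b = y div 2 ^ b"
proof -
  have "(2::nat) ^ b = 2 ^ a * 2 ^ (b - a)" using assms(2) by (simp flip: power_add)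
  then show ?thesis using assms(1) by (simp add: div_mult2_eq)
qed

lemma card_div_power_eq: "card {x::nat. x div 2 ^ a = q} = 2 ^ a" "finite {x::nat. x div 2 ^ a = q}"
proof -
  have "{x::nat. x div 2 ^ a = q} = {q * 2 ^ a..<(q + 1) * 2 ^ a}"
    by (auto simp: div_power_eq_iff)
  then show "card {x::nat. x div 2 ^ a = q} = 2 ^ a" "finite {x::nat. x div 2 ^ a = q}" by simp_all
qed

locale scheduling =
  fixes m n T :: nat and prec :: "nat rel"
  assumes precedence_order: "precedence_order n prec"
begin

abbreviation jobs :: "nat set" where "jobs \<equiv> {1..n}"

abbreviation feasible :: "nat \<Rightarrow> (nat \<Rightarrow> nat) \<Rightarrow> (nat \<Rightarrow> nat) \<Rightarrow> bool" where
  "feasible \<equiv> window_feasible m n prec T"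

abbreviation chain :: "nat list \<Rightarrow> bool" where
  "chain \<equiv> sorted_wrt (\<lambda>i j. (i, j) \<in> prec)"

lemma prec_jobs: "(i, j) \<in> prec \<Longrightarrow> i \<in> jobs \<and> j \<in> jobs"
  and prec_irrefl: "(i, i) \<notin> prec"
  and irrefl_prec: "irrefl prec"
  and trans_prec: "trans prec"
  and prec_trans: "(i, j) \<in> prec \<Longrightarrow> (j, l) \<in> prec \<Longrightarrow> (i, l) \<in> prec"
  using precedence_order by (auto simp: precedence_order_def irrefl_def dest: transD)

lemma chain_distinct: "chain xs \<Longrightarrow> distinct xs"
  by (induction xs) (auto simp: prec_irrefl)

lemma feasible_mono: "feasible s' rl dl \<Longrightarrow> s \<le> s' \<Longrightarrow> feasible s rl dl"
  by (induction s' arbitrary: s) (auto simp: le_Suc_eq dest: window_feasible_Suc)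

text \<open>The order information that weak cuts preserve. It suffices to order jobs lying in
  different dyadic intervals; inside one interval the order must come from elsewhere.\<close>

definition consistent :: "(nat \<Rightarrow> nat) \<Rightarrow> (nat \<Rightarrow> nat) \<Rightarrow> bool" where
  "consistent rl dl \<longleftrightarrow> (\<forall>j\<in>jobs. rl j \<le> dl j) \<and> (\<forall>i j. (i, j) \<in> prec \<longrightarrow> rl i \<le> rl j \<and> dl i \<le> dl j)"

text \<open>The node \<open>(e, q)\<close> is the interval of the times \<open>t\<close> with \<open>t div 2 ^ Suc e = q\<close>.\<close>

definition owned :: "(nat \<Rightarrow> nat) \<Rightarrow> (nat \<Rightarrow> nat) \<Rightarrow> nat \<Rightarrow> nat \<Rightarrow> nat set" where
  "owned rl dl e q = {j \<in> jobs. rl j div 2 ^ Suc e = q \<and> dl j div 2 ^ Suc e = q \<and>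
     rl j div 2 ^ e \<noteq> dl j div 2 ^ e}"

text \<open>The bound is proportional to the length of the interval, so that the intervals of one
  level together contribute a fraction \<open>1 / D\<close> of the length of the root.\<close>

definition short :: "nat \<Rightarrow> (nat \<Rightarrow> nat) \<Rightarrow> (nat \<Rightarrow> nat) \<Rightarrow> nat \<Rightarrow> nat \<Rightarrow> bool" where
  "short D rl dl e q \<longleftrightarrow>
     (\<forall>xs. chain xs \<longrightarrow> set xs \<subseteq> owned rl dl e q \<longrightarrow> D * length xs \<le> 2 ^ Suc e)"

text \<open>The level \<open>h\<close> records how far window ends may move: never out of their
  interval of length \<open>2 ^ h\<close>. Hence everything defined through intervals of at least
  this length is unchanged.\<close>

definition refines :: "nat \<Rightarrow> (nat \<Rightarrow> nat) \<Rightarrow> (nat \<Rightarrow> nat) \<Rightarrow> (nat \<Rightarrow> nat) \<Rightarrow> (nat \<Rightarrow> nat) \<Rightarrow> bool" where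
  "refines h rl dl rl' dl' \<longleftrightarrow> consistent rl' dl' \<and> (\<forall>i\<in>jobs. rl i \<le> rl' i \<and> dl' i \<le> dl i \<and>
     rl' i div 2 ^ h = rl i div 2 ^ h \<and> dl' i div 2 ^ h = dl i div 2 ^ h)"

text \<open>Protects the other nodes of the level being processed, whose owned jobs
  \<open>refines (Suc e)\<close> alone does not control.\<close>

definition changes_in :: "nat \<Rightarrow> nat \<Rightarrow> (nat \<Rightarrow> nat) \<Rightarrow> (nat \<Rightarrow> nat) \<Rightarrow> (nat \<Rightarrow> nat) \<Rightarrow> (nat \<Rightarrow> nat) \<Rightarrow> bool" where
  "changes_in h q rl dl rl' dl' \<longleftrightarrow> (\<forall>i\<in>jobs. (rl i div 2 ^ h \<noteq> q \<longrightarrow> rl' i = rl i) \<and>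
     (dl i div 2 ^ h \<noteq> q \<longrightarrow> dl' i = dl i))"

lemma refines_refl: "consistent rl dl \<Longrightarrow> refines h rl dl rl dl"
  by (simp add: refines_def)

lemma changes_in_refl: "changes_in h q rl dl rl dl"
  by (simp add: changes_in_def)

lemma refines_trans:
  "refines h rl dl rl' dl' \<Longrightarrow> refines h rl' dl' rl'' dl'' \<Longrightarrow> refines h rl dl rl'' dl''"
  unfolding refines_def by (fastforce intro: order.trans)

lemma refines_coarsen: "refines a rl dl rl' dl' \<Longrightarrow> a \<le> b \<Longrightarrow> refines b rl dl rl' dl'"
  unfolding refines_def by (blast intro: div_power_coarsen)

lemma refines_owned:
  assumes "refines h rl dl rl' dl'" "h \<le> e"
  shows "owned rl' dl' e q = owned rl dl e q"
proof -
  have "refines e rl dl rl' dl'" "refines (Suc e) rl dl rl' dl'"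
    using refines_coarsen[OF assms(1)] assms(2) by simp_all
  then show ?thesis unfolding owned_def refines_def by auto
qed

lemma refines_short:
  assumes "refines h rl dl rl' dl'" "h \<le> e"
  shows "short D rl' dl' e q \<longleftrightarrow> short D rl dl e q"
  by (simp add: short_def refines_owned[OF assms])

lemma finite_owned: "finite (owned rl dl e q)"
  by (simp add: owned_def)

text \<open>
  Conditioning on a job owned by the node \<open>(e, q)\<close> only moves window ends within this node, because a
  predecessor whose deadline is cut has its old deadline between \<open>t\<close> and the deadline of \<open>j\<close>.
\<close>

lemma condition_step:
  assumes F: "feasible (Suc s) rl dl" and c: "consistent rl dl" and j: "j \<in> owned rl dl e q"
  shows "\<exists>t rl' dl'. feasible s rl' dl' \<and> refines (Suc e) rl dl rl' dl' \<and>
     changes_in (Suc e) q rl dl rl' dl' \<and> t div 2 ^ Suc e = q \<and>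
     (\<forall>i\<in>jobs. i = j \<or> (i, j) \<in> prec \<longrightarrow> dl' i \<le> t) \<and>
     (\<forall>i\<in>jobs. i = j \<or> (j, i) \<in> prec \<longrightarrow> t \<le> rl' i)"
proof -
  have jJ: "j \<in> jobs" and jq: "rl j div 2 ^ Suc e = q" "dl j div 2 ^ Suc e = q"
    using j by (auto simp: owned_def)
  obtain t where t: "rl j \<le> t" "t \<le> dl j"
    and F': "feasible s (\<lambda>i. if i = j then t else if (j, i) \<in> prec then max (rl i) t else rl i)
       (\<lambda>i. if i = j then t else if (i, j) \<in> prec then min (dl i) t else dl i)"
    using window_feasible_condition[OF F jJ precedence_order] by blast
  define rl' where "rl' i = (if i = j then t else if (j, i) \<in> prec then max (rl i) t else rl i)" for i
  define dl' where "dl' i = (if i = j then t else if (i, j) \<in> prec then min (dl i) t else dl i)" for i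
  have cw: "rl i \<le> dl i" if "i \<in> jobs" for i using c that by (auto simp: consistent_def)
  have cr: "rl i \<le> rl l" "dl i \<le> dl l" if "(i, l) \<in> prec" for i l
    using c that by (auto simp: consistent_def)
  have between: "x div 2 ^ Suc e = q" if "rl j \<le> x" "x \<le> dl j" for x
    using div_le_mono[OF that(1), of "2 ^ Suc e"] div_le_mono[OF that(2), of "2 ^ Suc e"] jq by simp
  have tq: "t div 2 ^ Suc e = q" using between t by blast
  have rl_ch: "rl i \<le> rl' i \<and> (rl' i = rl i \<or> (rl i div 2 ^ Suc e = q \<and> rl' i div 2 ^ Suc e = q))"
    if "i \<in> jobs" for i
  proof (cases "(j, i) \<in> prec \<and> rl i < t")
    case True
    then have "rl j \<le> rl i" "rl i \<le> dl j" using cr(1) t by auto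
    then show ?thesis using True between tq by (auto simp: rl'_def prec_irrefl)
  next
    case False
    then show ?thesis using jq(1) tq t by (auto simp: rl'_def)
  qed
  have dl_ch: "dl' i \<le> dl i \<and> (dl' i = dl i \<or> (dl i div 2 ^ Suc e = q \<and> dl' i div 2 ^ Suc e = q))"
    if "i \<in> jobs" for i
  proof (cases "(i, j) \<in> prec \<and> t < dl i")
    case True
    then have "rl j \<le> dl i" "dl i \<le> dl j" using cr(2) t by auto
    then show ?thesis using True between tq by (auto simp: dl'_def prec_irrefl)
  next
    case False
    then show ?thesis using jq(2) tq t by (auto simp: dl'_def)
  qed
  have "consistent rl' dl'"
    unfolding consistent_def
  proof (intro conjI ballI allI impI)
    fix i
    assume i: "i \<in> jobs"
    show "rl' i \<le> dl' i"
      using cw[OF i] t cr[of i j] cr[of j i] prec_trans[of i j i] prec_irrefl[of i]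
      by (auto simp: rl'_def dl'_def)
  next
    fix i l
    assume il: "(i, l) \<in> prec"
    show "rl' i \<le> rl' l"
    proof (cases "l = j")
      case True
      then show ?thesis using cr(1)[OF il] il t prec_trans[of i j i] prec_irrefl by (auto simp: rl'_def)
    next
      case False
      then show ?thesis using cr(1)[OF il] il t prec_trans[of j i l] by (auto simp: rl'_def)
    qed
    show "dl' i \<le> dl' l"
    proof (cases "i = j")
      case True
      then show ?thesis using cr(2)[OF il] il t prec_trans[of j l j] prec_irrefl by (auto simp: dl'_def)
    next
      case False
      then show ?thesis using cr(2)[OF il] il t prec_trans[of i l j] by (auto simp: dl'_def)
    qed
  qed
  then have "refines (Suc e) rl dl rl' dl'"
    unfolding refines_def using rl_ch dl_ch by (metis (no_types))
  moreover have "changes_in (Suc e) q rl dl rl' dl'"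
    unfolding changes_in_def using rl_ch dl_ch by blast
  moreover have "feasible s rl' dl'" using F' by (simp add: rl'_def[abs_def] dl'_def[abs_def])
  moreover have "\<forall>i\<in>jobs. i = j \<or> (i, j) \<in> prec \<longrightarrow> dl' i \<le> t" by (auto simp: dl'_def)
  moreover have "\<forall>i\<in>jobs. i = j \<or> (j, i) \<in> prec \<longrightarrow> t \<le> rl' i" by (auto simp: rl'_def)
  ultimately show ?thesis using tq by blast
qed

lemma chain_nth:
  assumes "chain xs" "a < b" "b < length xs"
  shows "(xs ! a, xs ! b) \<in> prec"
  using assms by (simp add: sorted_wrt_iff_nth_less)

text \<open>Let the median \<open>j\<close> of the chain be placed at \<open>t\<close>. If
  \<open>t\<close> is in the left half, \<open>j\<close> and its predecessors get deadlines up to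
  \<open>t\<close>, so their windows lie in the left half; otherwise the same holds for
  \<open>j\<close>, its successors and the right half. Either way half of a chain longer than
  \<open>2 ^ Suc e / D\<close> is no longer owned by the node, and no new job becomes owned by
  it.\<close>

lemma halving_step:
  assumes F: "feasible (Suc s) rl dl" and c: "consistent rl dl"
    and xs: "chain xs" "set xs \<subseteq> owned rl dl e q" "D * length xs > 2 ^ Suc e"
  shows "\<exists>rl' dl'. feasible s rl' dl' \<and> refines (Suc e) rl dl rl' dl' \<and>
     changes_in (Suc e) q rl dl rl' dl' \<and>
     2 * D * card (owned rl' dl' e q) + 2 ^ Suc e \<le> 2 * D * card (owned rl dl e q)"
proof -
  define l where "l = length xs"
  define j where "j = xs ! (l div 2)"
  have l: "l > 0" using xs(3) l_def by (metis gr0I mult_0_right not_less_zero)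
  then have l2: "l div 2 < l" by simp
  have j: "j \<in> owned rl dl e q" using xs(2) nth_mem[of "l div 2" xs] l2 unfolding j_def l_def by blast
  obtain t rl' dl' where F': "feasible s rl' dl'" and r: "refines (Suc e) rl dl rl' dl'"
    and ch: "changes_in (Suc e) q rl dl rl' dl'" and tq: "t div 2 ^ Suc e = q"
    and pre: "\<forall>i\<in>jobs. i = j \<or> (i, j) \<in> prec \<longrightarrow> dl' i \<le> t"
    and suc: "\<forall>i\<in>jobs. i = j \<or> (j, i) \<in> prec \<longrightarrow> t \<le> rl' i"
    using condition_step[OF F c j] by (elim exE conjE) (rule that)
  have sub: "owned rl' dl' e q \<subseteq> owned rl dl e q"
  proof
    fix i
    assume i: "i \<in> owned rl' dl' e q"
    then have iJ: "i \<in> jobs" by (simp add: owned_def)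
    have "rl i \<le> rl' i" "rl' i \<le> dl' i" "dl' i \<le> dl i"
      and eq: "rl' i div 2 ^ Suc e = rl i div 2 ^ Suc e" "dl' i div 2 ^ Suc e = dl i div 2 ^ Suc e"
      using r iJ unfolding refines_def consistent_def by blast+
    then have "rl i div 2 ^ e \<le> rl' i div 2 ^ e" "rl' i div 2 ^ e \<le> dl' i div 2 ^ e"
      "dl' i div 2 ^ e \<le> dl i div 2 ^ e" by (simp_all add: div_le_mono)
    moreover have "rl i div 2 ^ Suc e = q" "dl i div 2 ^ Suc e = q" "rl' i div 2 ^ e \<noteq> dl' i div 2 ^ e"
      using i eq unfolding owned_def by auto
    ultimately show "i \<in> owned rl dl e q" using iJ unfolding owned_def by simp
  qed
  have half: "x div 2 ^ Suc e = x div 2 ^ e div 2" for x :: nat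
    by (metis div_mult2_eq power_Suc mult.commute)
  have "\<exists>Y \<subseteq> owned rl dl e q. Y \<inter> owned rl' dl' e q = {} \<and> l \<le> 2 * card Y"
  proof (cases "t div 2 ^ e = 2 * q")
    case True
    \<comment> \<open>The median is counted in both cases, which makes \<open>take\<close> and
      \<open>drop\<close> each contain at least half of the chain.\<close>
    let ?Y = "set (take (Suc (l div 2)) xs)"
    have "i \<notin> owned rl' dl' e q" if "i \<in> ?Y" for i
    proof
      assume i: "i \<in> owned rl' dl' e q"
      obtain a where a: "a < Suc (l div 2)" "i = xs ! a" "a < l"
        using \<open>i \<in> ?Y\<close> by (auto simp: in_set_conv_nth l_def)
      have "i = j \<or> (i, j) \<in> prec"
        using chain_nth[OF xs(1), of a "l div 2"] a l2 by (cases "a = l div 2") (auto simp: j_def l_def)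
      then have "dl' i \<le> t" using pre[rule_format, of i] i unfolding owned_def by blast
      then have "dl' i div 2 ^ e \<le> 2 * q" using div_le_mono True by metis
      moreover have "rl' i div 2 ^ e \<le> dl' i div 2 ^ e"
        using r i by (intro div_le_mono) (auto simp: refines_def consistent_def owned_def)
      moreover have "rl' i div 2 ^ e div 2 = q" using i half by (simp add: owned_def)
      moreover have "rl' i div 2 ^ e \<noteq> dl' i div 2 ^ e" using i by (simp add: owned_def)
      ultimately show False by linarith
    qed
    moreover have "card ?Y = Suc (l div 2)"
      using distinct_card[OF distinct_take[OF chain_distinct[OF xs(1)]]] l2
      by (simp add: l_def[symmetric] min_def)
    moreover have "?Y \<subseteq> owned rl dl e q" using xs(2) set_take_subset by fastforce
    ultimately show ?thesis by (intro exI[of _ ?Y]) auto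
  next
    case False
    then have t1: "t div 2 ^ e \<ge> 2 * q + 1" using tq half[of t] by linarith
    let ?Y = "set (drop (l div 2) xs)"
    have "i \<notin> owned rl' dl' e q" if "i \<in> ?Y" for i
    proof
      assume i: "i \<in> owned rl' dl' e q"
      obtain b where b: "l div 2 + b < l" "i = xs ! (l div 2 + b)"
        using \<open>i \<in> ?Y\<close> by (force simp: in_set_conv_nth l_def)
      have "i = j \<or> (j, i) \<in> prec"
        using chain_nth[OF xs(1), of "l div 2" "l div 2 + b"] b by (cases "b = 0") (auto simp: j_def l_def)
      then have "t \<le> rl' i" using suc[rule_format, of i] i unfolding owned_def by blast
      then have "2 * q + 1 \<le> rl' i div 2 ^ e" using div_le_mono t1 by (metis le_trans)
      moreover have "rl' i div 2 ^ e \<le> dl' i div 2 ^ e"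
        using r i by (intro div_le_mono) (auto simp: refines_def consistent_def owned_def)
      moreover have "dl' i div 2 ^ e div 2 = q" using i half by (simp add: owned_def)
      moreover have "rl' i div 2 ^ e \<noteq> dl' i div 2 ^ e" using i by (simp add: owned_def)
      ultimately show False by linarith
    qed
    moreover have "card ?Y = l - l div 2"
      using distinct_card[OF distinct_drop[OF chain_distinct[OF xs(1)]]] by (simp add: l_def[symmetric])
    moreover have "?Y \<subseteq> owned rl dl e q" using xs(2) set_drop_subset by fastforce
    ultimately show ?thesis by (intro exI[of _ ?Y]) auto
  qed
  then obtain Y where Y: "Y \<subseteq> owned rl dl e q" "Y \<inter> owned rl' dl' e q = {}" "l \<le> 2 * card Y" by blast
  have "card (owned rl' dl' e q) + card Y = card (owned rl' dl' e q \<union> Y)"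
    using Y(1,2) finite_owned finite_subset by (subst card_Un_disjoint) blast+
  also have "\<dots> \<le> card (owned rl dl e q)" using Y(1) sub by (intro card_mono finite_owned) auto
  finally have "2 * D * (card (owned rl' dl' e q) + card Y) \<le> 2 * D * card (owned rl dl e q)"
    by (rule mult_left_mono) simp
  moreover have "2 ^ Suc e \<le> 2 * D * card Y"
  proof -
    have "2 ^ Suc e \<le> D * l" using xs(3) by (simp add: l_def)
    also have "\<dots> \<le> D * (2 * card Y)" using Y(3) by (rule mult_le_mono2)
    finally show ?thesis by (simp only: ac_simps)
  qed
  ultimately have "2 * D * card (owned rl' dl' e q) + 2 ^ Suc e \<le> 2 * D * card (owned rl dl e q)"
    by (simp add: add_mult_distrib2)
  then show ?thesis using F' r ch by blast
qed

lemma process_node_aux: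
  assumes "feasible (s + x) rl dl" "consistent rl dl" "2 * D * card (owned rl dl e q) \<le> x * 2 ^ Suc e"
  shows "\<exists>rl' dl'. feasible s rl' dl' \<and> refines (Suc e) rl dl rl' dl' \<and>
     changes_in (Suc e) q rl dl rl' dl' \<and> short D rl' dl' e q"
  using assms
proof (induction x arbitrary: rl dl)
  case 0
  then have "D * card (owned rl dl e q) = 0" by simp
  have "D * length xs = 0" if "set xs \<subseteq> owned rl dl e q" for xs
  proof (cases "D = 0")
    case False
    then have "owned rl dl e q = {}" using \<open>D * card (owned rl dl e q) = 0\<close> finite_owned by simp
    then show ?thesis using that by simp
  qed simp
  then have "short D rl dl e q" unfolding short_def by (metis le0)
  then show ?case using 0 refines_refl changes_in_refl by (metis add_0_right)
next
  case (Suc x)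
  show ?case
  proof (cases "short D rl dl e q")
    case True
    moreover have "feasible s rl dl" using Suc.prems(1) by (rule feasible_mono) simp
    ultimately show ?thesis using Suc.prems(2) refines_refl changes_in_refl by blast
  next
    case False
    then obtain xs where xs: "chain xs" "set xs \<subseteq> owned rl dl e q" "D * length xs > 2 ^ Suc e"
      unfolding short_def by (meson not_le)
    have "feasible (Suc (s + x)) rl dl" using Suc.prems(1) by simp
    from halving_step[OF this Suc.prems(2) xs] obtain rl' dl' where
      1: "feasible (s + x) rl' dl'" "refines (Suc e) rl dl rl' dl'" "changes_in (Suc e) q rl dl rl' dl'"
         "2 * D * card (owned rl' dl' e q) + 2 ^ Suc e \<le> 2 * D * card (owned rl dl e q)" by blast
    have "consistent rl' dl'" using 1(2) by (simp add: refines_def)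
    moreover have "2 * D * card (owned rl' dl' e q) \<le> x * 2 ^ Suc e" using 1(4) Suc.prems(3) by simp
    ultimately obtain rl'' dl'' where 2: "feasible s rl'' dl''" "refines (Suc e) rl' dl' rl'' dl''"
      "changes_in (Suc e) q rl' dl' rl'' dl''" "short D rl'' dl'' e q"
      using Suc.IH[OF 1(1)] by blast
    have "changes_in (Suc e) q rl dl rl'' dl''"
      using 1(3) 2(3) unfolding changes_in_def by metis
    then show ?thesis using 2 refines_trans[OF 1(2) 2(2)] by blast
  qed
qed

lemma node_hall:
  assumes "feasible s rl dl"
  shows "card {j \<in> jobs. rl j div 2 ^ h = q \<and> dl j div 2 ^ h = q} \<le> m * 2 ^ h"
proof -
  have "card {j \<in> jobs. rl j div 2 ^ h = q \<and> dl j div 2 ^ h = q}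
     \<le> card {j \<in> jobs. q * 2 ^ h \<le> rl j \<and> dl j \<le> q * 2 ^ h + (2 ^ h - 1)}"
    by (intro card_mono) (auto simp: div_power_eq_iff)
  also have "\<dots> \<le> m * 2 ^ h"
    using window_feasible_hall[OF assms, of "q * 2 ^ h" "q * 2 ^ h + (2 ^ h - 1)"] by simp
  finally show ?thesis .
qed

text \<open>By Hall's condition the node owns at most \<open>m * 2 ^ Suc e\<close> jobs, and each
  conditioning removes at least \<open>2 ^ Suc e / (2 * D)\<close> of them; hence the budget of
  \<open>2 * D * m\<close> rounds.\<close>

lemma process_node:
  assumes "feasible (s + 2 * D * m) rl dl" "consistent rl dl"
  shows "\<exists>rl' dl'. feasible s rl' dl' \<and> refines (Suc e) rl dl rl' dl' \<and>
     changes_in (Suc e) q rl dl rl' dl' \<and> short D rl' dl' e q"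
proof (rule process_node_aux[OF assms])
  have "card (owned rl dl e q) \<le> card {j \<in> jobs. rl j div 2 ^ Suc e = q \<and> dl j div 2 ^ Suc e = q}"
    by (intro card_mono) (auto simp: owned_def)
  also have "\<dots> \<le> m * 2 ^ Suc e" by (rule node_hall[OF assms(1)])
  finally show "2 * D * card (owned rl dl e q) \<le> 2 * D * m * 2 ^ Suc e" by simp
qed

text \<open>A job owned by \<open>q'\<close> afterwards has both ends in \<open>q'\<close>, where
  nothing has moved, so it was owned by \<open>q'\<close> before.\<close>

lemma changes_in_short:
  assumes "refines (Suc e) rl dl rl' dl'" "changes_in (Suc e) q rl dl rl' dl'" "q' \<noteq> q"
    "short D rl dl e q'"
  shows "short D rl' dl' e q'"
proof -
  have "owned rl' dl' e q' \<subseteq> owned rl dl e q'"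
    using assms(1-3) unfolding owned_def refines_def changes_in_def by auto
  then show ?thesis using assms(4) unfolding short_def by blast
qed

lemma process_level:
  assumes "finite Q" "feasible (s + card Q * (2 * D * m)) rl dl" "consistent rl dl"
  shows "\<exists>rl' dl'. feasible s rl' dl' \<and> refines (Suc e) rl dl rl' dl' \<and> (\<forall>q\<in>Q. short D rl' dl' e q)"
  using assms
proof (induction Q arbitrary: s rule: finite_induct)
  case empty
  then show ?case using refines_refl by (metis add_0_right card.empty empty_iff mult_0)
next
  case (insert q Q)
  have "feasible (s + 2 * D * m + card Q * (2 * D * m)) rl dl"
    using insert.prems(1) insert.hyps by (simp add: algebra_simps)
  then obtain rl' dl' where 1: "feasible (s + 2 * D * m) rl' dl'" "refines (Suc e) rl dl rl' dl'"
      "\<forall>q\<in>Q. short D rl' dl' e q" using insert.IH insert.prems(2) by blast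
  obtain rl'' dl'' where 2: "feasible s rl'' dl''" "refines (Suc e) rl' dl' rl'' dl''"
      "changes_in (Suc e) q rl' dl' rl'' dl''" "short D rl'' dl'' e q"
    using process_node[OF 1(1)] 1(2) unfolding refines_def by blast
  have "short D rl'' dl'' e q'" if "q' \<in> Q" for q'
    using changes_in_short[OF 2(2,3)] 1(3) that insert.hyps by metis
  then show ?case using 2 refines_trans[OF 1(2) 2(2)] by blast
qed

text \<open>Levels are treated from \<open>u - 1\<close> down to \<open>c\<close>, because
  conditioning at level \<open>e\<close> leaves the jobs owned at higher levels unchanged. Level
  \<open>e\<close> has \<open>2 ^ (h - Suc e)\<close> nodes below the root, and these numbers add up
  to at most \<open>2 ^ (h - c)\<close>. Levels from \<open>u\<close> on are left alone: in the
  recursion they were made short earlier.\<close>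

lemma process_levels:
  assumes "c \<le> u" "u \<le> h" "feasible (s + 2 ^ (h - c) * (2 * D * m)) rl dl" "consistent rl dl"
  shows "\<exists>rl' dl'. feasible s rl' dl' \<and> refines u rl dl rl' dl' \<and>
    (\<forall>e q'. c \<le> e \<longrightarrow> e < u \<longrightarrow> q' div 2 ^ (h - Suc e) = q \<longrightarrow> short D rl' dl' e q')"
  using assms(1,3)
proof (induction arbitrary: s rule: inc_induct)
  case base
  then have "feasible s rl dl" by (rule feasible_mono) simp
  then show ?case using refines_refl[OF assms(4)] by (meson not_le)
next
  case (step c)
  have "(2::nat) ^ (h - c) = 2 * 2 ^ (h - Suc c)"
    using step.hyps assms(2) by (metis Suc_diff_Suc le_trans less_eq_Suc_le power_Suc)
  then have "feasible ((s + 2 ^ (h - Suc c) * (2 * D * m)) + 2 ^ (h - Suc c) * (2 * D * m)) rl dl"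
    using step.prems by (simp add: algebra_simps)
  from step.IH[OF this] obtain rl' dl' where
    1: "feasible (s + 2 ^ (h - Suc c) * (2 * D * m)) rl' dl'" "refines u rl dl rl' dl'"
       "\<And>e q'. Suc c \<le> e \<Longrightarrow> e < u \<Longrightarrow> q' div 2 ^ (h - Suc e) = q \<Longrightarrow> short D rl' dl' e q'" by blast
  have c': "consistent rl' dl'" using 1(2) by (simp add: refines_def)
  obtain rl'' dl'' where 2: "feasible s rl'' dl''" "refines (Suc c) rl' dl' rl'' dl''"
      "\<forall>q'\<in>{x. x div 2 ^ (h - Suc c) = q}. short D rl'' dl'' c q'"
    using process_level[OF card_div_power_eq(2), of s "h - Suc c" q D rl' dl' c] 1(1) c'
    by (auto simp: card_div_power_eq(1))
  have "refines u rl dl rl'' dl''"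
    using refines_trans[OF 1(2) refines_coarsen[OF 2(2)]] step.hyps by simp
  moreover have "short D rl'' dl'' e q'"
    if "c \<le> e" "e < u" "q' div 2 ^ (h - Suc e) = q" for e q'
  proof (cases "e = c")
    case True
    then show ?thesis using 2(3) that by simp
  next
    case False
    then show ?thesis using refines_short[OF 2(2), of e] 1(3) that by simp
  qed
  ultimately show ?case using 2(1) by blast
qed

section \<open>Inserting the top jobs\<close>

definition valid :: "(nat \<Rightarrow> nat) \<Rightarrow> (nat \<Rightarrow> nat) \<Rightarrow> nat set \<Rightarrow> (nat \<Rightarrow> nat option) \<Rightarrow> bool" where
  "valid rl dl U \<sigma> \<longleftrightarrow> (\<forall>j\<in>U. \<forall>t. \<sigma> j = Some t \<longrightarrow> rl j \<le> t \<and> t \<le> dl j) \<and>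
     (\<forall>t. card {j \<in> U. \<sigma> j = Some t} \<le> m) \<and>
     (\<forall>i\<in>U. \<forall>j\<in>U. \<forall>t u. (i, j) \<in> prec \<longrightarrow> \<sigma> i = Some t \<longrightarrow> \<sigma> j = Some u \<longrightarrow> t < u)"

text \<open>The jobs of the subtree with root interval \<open>t div 2 ^ h = q\<close> that remain
  below a cut at level \<open>c\<close>; for \<open>c = h\<close> these are all its jobs. The
  difference between two values of \<open>c\<close> is a band.\<close>

definition inside :: "(nat \<Rightarrow> nat) \<Rightarrow> (nat \<Rightarrow> nat) \<Rightarrow> nat \<Rightarrow> nat \<Rightarrow> nat \<Rightarrow> nat set" where
  "inside rl dl h q c = {j \<in> jobs. rl j div 2 ^ h = q \<and> dl j div 2 ^ h = q \<and>
     rl j div 2 ^ c = dl j div 2 ^ c}"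

abbreviation discarded :: "nat set \<Rightarrow> (nat \<Rightarrow> nat option) \<Rightarrow> nat set" where
  "discarded U \<sigma> \<equiv> {j \<in> U. \<sigma> j = None}"

lemma finite_inside: "finite (inside rl dl h q c)"
  by (simp add: inside_def)

lemma owner_exists:
  assumes j: "j \<in> jobs" "rl j div 2 ^ h = q" "dl j div 2 ^ h = q" "rl j div 2 ^ c \<noteq> dl j div 2 ^ c"
    and "c \<le> h"
  shows "\<exists>e q'. c \<le> e \<and> e < h \<and> q' div 2 ^ (h - Suc e) = q \<and> j \<in> owned rl dl e q'"
proof -
  have "\<exists>e. c \<le> e \<and> e < h \<and> rl j div 2 ^ e \<noteq> dl j div 2 ^ e \<and> rl j div 2 ^ Suc e = dl j div 2 ^ Suc e"
  proof (rule ccontr)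
    assume *: "\<nexists>e. c \<le> e \<and> e < h \<and> rl j div 2 ^ e \<noteq> dl j div 2 ^ e \<and>
       rl j div 2 ^ Suc e = dl j div 2 ^ Suc e"
    have "rl j div 2 ^ h \<noteq> dl j div 2 ^ h"
      using \<open>c \<le> h\<close>
    proof (induction rule: dec_induct)
      case base
      then show ?case using j(4) .
    next
      case (step e)
      then show ?case using * by auto
    qed
    then show False using j by simp
  qed
  then obtain e where e: "c \<le> e" "e < h" "rl j div 2 ^ e \<noteq> dl j div 2 ^ e"
     "rl j div 2 ^ Suc e = dl j div 2 ^ Suc e" by blast
  have p: "(2::nat) ^ h = 2 ^ Suc e * 2 ^ (h - Suc e)" using e(2) by (metis le_add_diff_inverse less_eq_Suc_le power_add)
  have "rl j div 2 ^ Suc e div 2 ^ (h - Suc e) = q" using j(2) unfolding p div_mult2_eq .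
  moreover have "j \<in> owned rl dl e (rl j div 2 ^ Suc e)" using e j(1) by (simp add: owned_def)
  ultimately show ?thesis using e(1,2) by blast
qed

text \<open>Split the chain by owners. Each of the \<open>2 ^ (h - Suc e)\<close> nodes of level
  \<open>e\<close> owns at most \<open>2 ^ Suc e / D\<close> of its elements, so every level
  contributes at most \<open>2 ^ h / D\<close>.\<close>

lemma chain_bound:
  assumes sh: "\<And>e q'. c \<le> e \<Longrightarrow> e < h \<Longrightarrow> q' div 2 ^ (h - Suc e) = q \<Longrightarrow> short D rl dl e q'"
    and "c \<le> h" and xs: "chain xs"
    "set xs \<subseteq> {j \<in> jobs. rl j div 2 ^ h = q \<and> dl j div 2 ^ h = q \<and> rl j div 2 ^ c \<noteq> dl j div 2 ^ c}"
  shows "D * length xs \<le> (h - c) * 2 ^ h"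
proof -
  let ?N = "\<lambda>e. {q'::nat. q' div 2 ^ (h - Suc e) = q}"
  have sub: "set xs \<subseteq> (\<Union>e\<in>{c..<h}. \<Union>q'\<in>?N e. set xs \<inter> owned rl dl e q')"
  proof
    fix j
    assume j: "j \<in> set xs"
    then show "j \<in> (\<Union>e\<in>{c..<h}. \<Union>q'\<in>?N e. set xs \<inter> owned rl dl e q')"
      using owner_exists[of j rl h q dl c] xs(2) \<open>c \<le> h\<close> by fastforce
  qed
  have one: "D * card (set xs \<inter> owned rl dl e q') \<le> 2 ^ Suc e" if "c \<le> e" "e < h" "q' \<in> ?N e" for e q'
  proof -
    let ?ys = "filter (\<lambda>j. j \<in> owned rl dl e q') xs"
    have "chain ?ys" using xs(1) by (rule sorted_wrt_filter)
    moreover have "set ?ys = set xs \<inter> owned rl dl e q'" by auto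
    moreover have "length ?ys = card (set ?ys)"
      using chain_distinct[OF xs(1)] by (metis distinct_card distinct_filter)
    moreover have "D * length ?ys \<le> 2 ^ Suc e"
      using sh[of e q'] that \<open>chain ?ys\<close> unfolding short_def by auto
    ultimately show ?thesis by simp
  qed
  have "D * length xs = D * card (set xs)" using distinct_card[OF chain_distinct[OF xs(1)]] by simp
  also have "\<dots> \<le> D * card (\<Union>e\<in>{c..<h}. \<Union>q'\<in>?N e. set xs \<inter> owned rl dl e q')"
    using sub by (intro mult_left_mono card_mono) (auto simp: card_div_power_eq)
  also have "\<dots> \<le> D * (\<Sum>e\<in>{c..<h}. card (\<Union>q'\<in>?N e. set xs \<inter> owned rl dl e q'))"
    by (intro mult_left_mono card_UN_le) auto
  also have "\<dots> \<le> D * (\<Sum>e\<in>{c..<h}. \<Sum>q'\<in>?N e. card (set xs \<inter> owned rl dl e q'))"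
    by (intro mult_left_mono sum_mono card_UN_le card_div_power_eq) auto
  also have "\<dots> = (\<Sum>e\<in>{c..<h}. \<Sum>q'\<in>?N e. D * card (set xs \<inter> owned rl dl e q'))"
    by (simp only: sum_distrib_left)
  also have "\<dots> \<le> (\<Sum>e\<in>{c..<h}. \<Sum>q'\<in>?N e. 2 ^ Suc e)"
    using one by (intro sum_mono) auto
  also have "\<dots> = (\<Sum>e\<in>{c..<h}. 2 ^ h)"
  proof (intro sum.cong refl)
    fix e
    assume "e \<in> {c..<h}"
    then have "(2::nat) ^ (h - Suc e) * 2 ^ Suc e = 2 ^ h"
      by (metis atLeastLessThan_iff less_eq_Suc_le le_add_diff_inverse2 power_add)
    then show "(\<Sum>q'\<in>?N e. 2 ^ Suc e) = (2::nat) ^ h" by (simp add: card_div_power_eq)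
  qed
  also have "\<dots> = (h - c) * 2 ^ h" by simp
  finally show ?thesis .
qed

text \<open>
  Position \<open>2 * y + 1\<close> stands for the block \<open>y\<close> of length \<open>2 ^ c\<close>, and \<open>2 * z\<close> for a dummy position between
  the blocks \<open>z - 1\<close> and \<open>z\<close>.  Shrinking the windows by a block at both ends violates Hall's condition by
  at most the capacity of two blocks, which the dummies at multiples of \<open>2 ^ k\<close> provide; jobs
  matched to dummies will be discarded.
\<close>

lemma top_jobs_hall:
  fixes u v :: nat
  assumes F: "feasible s rl dl" and c: "consistent rl dl"
    and \<sigma>: "valid rl dl Q \<sigma>" and Q: "Q \<subseteq> jobs" "\<And>j. j \<in> Q \<Longrightarrow> rl j div 2 ^ c = dl j div 2 ^ c"
    and P: "P \<subseteq> jobs" "\<And>j. j \<in> P \<Longrightarrow> rl j div 2 ^ (c + k) \<noteq> dl j div 2 ^ (c + k)"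
    and load: "\<And>t. load t = card {j \<in> Q. \<sigma> j = Some t}"
    and cap: "\<And>y. cap (2 * y + 1) = m * 2 ^ c - sum load {t. t div 2 ^ c = y}"
      "\<And>z. 2 ^ k dvd z \<Longrightarrow> cap (2 * z) = 2 * m * 2 ^ c"
  shows "card {j \<in> P. u \<le> 2 * (rl j div 2 ^ c) + 2 \<and> 2 * (dl j div 2 ^ c) \<le> v} \<le> sum cap {u..v}"
proof -
  let ?B = "\<lambda>y. {t::nat. t div 2 ^ c = y}"
  define X where "X = {j \<in> P. u \<le> 2 * (rl j div 2 ^ c) + 2 \<and> 2 * (dl j div 2 ^ c) \<le> v}"
  have loadm: "load t \<le> m" for t using \<sigma> by (simp add: load valid_def)
  have finQ: "finite Q" and finP: "finite P" using Q P finite_subset by blast+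
  show ?thesis
  proof (cases "X = {}")
    case True
    then show ?thesis unfolding X_def[symmetric] by simp
  next
    case False
    then obtain j0 where j0: "j0 \<in> P" "u \<le> 2 * (rl j0 div 2 ^ c) + 2" "2 * (dl j0 div 2 ^ c) \<le> v"
      by (auto simp: X_def)
    \<comment> \<open>The first block of the coarse interval containing \<open>dl j0\<close>. As the
      window of \<open>j0\<close> crosses a coarse boundary, the dummy position before this block
      lies between \<open>u\<close> and \<open>v\<close>.\<close>
    define z where "z = 2 ^ k * (dl j0 div 2 ^ (c + k))"
    have split: "x div 2 ^ (c + k) = x div 2 ^ c div 2 ^ k" for x :: nat
      by (simp add: power_add div_mult2_eq)
    have "rl j0 \<le> dl j0" using c j0(1) P(1) by (auto simp: consistent_def)
    then have "rl j0 div 2 ^ (c + k) < dl j0 div 2 ^ (c + k)"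
      using P(2)[OF j0(1)] div_le_mono[of "rl j0" "dl j0" "2 ^ (c + k)"] by linarith
    then have "rl j0 div 2 ^ c div 2 ^ k < dl j0 div 2 ^ (c + k)" by (simp only: split)
    then have z1: "rl j0 div 2 ^ c < z"
      unfolding z_def by (metis div_less_iff_less_mult mult.commute zero_less_numeral zero_less_power)
    have z2: "z \<le> dl j0 div 2 ^ c" unfolding z_def split by (metis times_div_less_eq_dividend)
    have zcap: "cap (2 * z) = 2 * m * 2 ^ c" unfolding z_def by (rule cap(2)) simp
    \<comment> \<open>All windows of \<open>X\<close> lie in the blocks \<open>lo\<close> to
      \<open>hi\<close>, but only the blocks strictly between are sure to have their positions in
      \<open>{u..v}\<close>. The two lost blocks are what the dummy at \<open>z\<close>
      replaces.\<close>
    define lo where "lo = (u - 1) div 2"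
    define hi where "hi = v div 2"
    have lo: "lo \<le> x" if "u \<le> 2 * x + 2" for x
      using div_le_mono[of "u - 1" "2 * x + 1" 2] that unfolding lo_def by simp
    have hi: "x \<le> hi" if "2 * x \<le> v" for x
      using div_le_mono[OF that, of 2] unfolding hi_def by simp
    have lohi: "lo < hi" using lo[OF j0(2)] hi[OF j0(3)] z1 z2 by linarith
    let ?I = "{lo<..<hi}"
    \<comment> \<open>The bottom jobs occupying the inner blocks. Each has its window in one block,
      so Hall's condition of the LP applies to \<open>X \<union> Y\<close> and leaves for
      \<open>X\<close> just the free capacity.\<close>
    define Y where "Y = (\<Union>y\<in>?I. \<Union>t\<in>?B y. {j \<in> Q. \<sigma> j = Some t})"
    have "card Y = (\<Sum>y\<in>?I. card (\<Union>t\<in>?B y. {j \<in> Q. \<sigma> j = Some t}))"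
      unfolding Y_def by (rule card_UN_disjoint) (auto simp: finQ card_div_power_eq)
    also have "\<dots> = (\<Sum>y\<in>?I. sum load (?B y))"
      unfolding load by (intro sum.cong refl card_UN_disjoint) (auto simp: finQ card_div_power_eq)
    finally have cardY: "card Y = (\<Sum>y\<in>?I. sum load (?B y))" .
    have disj: "X \<inter> Y = {}"
    proof -
      have "j \<notin> Q" if "j \<in> P" for j
        using that P(2) Q(2) div_power_coarsen[of "rl j" c "dl j" "c + k"] by auto
      then show ?thesis by (auto simp: X_def Y_def)
    qed
    have XY: "X \<union> Y \<subseteq> {j \<in> jobs. lo * 2 ^ c \<le> rl j \<and> dl j \<le> (hi + 1) * 2 ^ c - 1}"
    proof
      fix j
      assume j: "j \<in> X \<union> Y"
      have "j \<in> jobs \<and> lo \<le> rl j div 2 ^ c \<and> dl j div 2 ^ c \<le> hi"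
      proof (cases "j \<in> X")
        case True
        then have "u \<le> 2 * (rl j div 2 ^ c) + 2" "2 * (dl j div 2 ^ c) \<le> v" "j \<in> jobs"
          using P(1) by (auto simp: X_def)
        then show ?thesis using lo hi by blast
      next
        case False
        then obtain t where t: "j \<in> Q" "\<sigma> j = Some t" "lo < t div 2 ^ c" "t div 2 ^ c < hi"
          using j by (auto simp: Y_def)
        then have "rl j \<le> t" "t \<le> dl j" using \<sigma> by (auto simp: valid_def)
        then have "rl j div 2 ^ c \<le> t div 2 ^ c" "t div 2 ^ c \<le> dl j div 2 ^ c"
          by (simp_all add: div_le_mono)
        then show ?thesis using t Q by (metis (no_types) le_antisym less_imp_le subsetD)
      qed
      then have "j \<in> jobs" "lo * 2 ^ c \<le> rl j" "dl j < (hi + 1) * 2 ^ c"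
        using div_less_iff_less_mult[of "2 ^ c" "dl j" "hi + 1"]
        by (simp_all add: less_eq_div_iff_mult_less_eq)
      then show "j \<in> {j \<in> jobs. lo * 2 ^ c \<le> rl j \<and> dl j \<le> (hi + 1) * 2 ^ c - 1}" by auto
    qed
    have "card X + card Y = card (X \<union> Y)"
      using disj finP by (intro card_Un_disjoint[symmetric])
        (auto simp: X_def Y_def finQ card_div_power_eq)
    also have "\<dots> \<le> card {j \<in> jobs. lo * 2 ^ c \<le> rl j \<and> dl j \<le> (hi + 1) * 2 ^ c - 1}"
      using XY by (intro card_mono) auto
    also have "\<dots> \<le> m * ((hi + 1) * 2 ^ c - 1 + 1 - lo * 2 ^ c)"
      by (rule window_feasible_hall[OF F])
    also have "\<dots> = m * ((hi + 1 - lo) * 2 ^ c)" by (simp add: diff_mult_distrib)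
    finally have le: "card X + card Y \<le> m * ((hi + 1 - lo) * 2 ^ c)" .
    have "(\<Sum>y\<in>?I. cap (2 * y + 1)) = (\<Sum>y\<in>?I. m * 2 ^ c) - (\<Sum>y\<in>?I. sum load (?B y))"
      unfolding cap(1)
    proof (rule sum_subtractf_nat)
      fix y
      have "sum load (?B y) \<le> (\<Sum>t\<in>?B y. m)" using loadm by (intro sum_mono)
      then show "sum load (?B y) \<le> m * 2 ^ c" by (simp add: card_div_power_eq mult.commute)
    qed
    then have real_cap: "(\<Sum>y\<in>?I. cap (2 * y + 1)) = (hi - lo - 1) * (m * 2 ^ c) - card Y"
      using cardY by simp
    have "(\<Sum>y\<in>?I. cap (2 * y + 1)) + cap (2 * z) = sum cap (insert (2 * z) ((\<lambda>y. 2 * y + 1) ` ?I))"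
    proof -
      have "2 * z \<notin> (\<lambda>y. 2 * y + 1) ` ?I" by (auto; presburger)
      then show ?thesis by (simp add: sum.reindex inj_on_def)
    qed
    also have "\<dots> \<le> sum cap {u..v}"
    proof (rule sum_mono2)
      show "insert (2 * z) ((\<lambda>y. 2 * y + 1) ` ?I) \<subseteq> {u..v}"
        using j0 z1 z2 unfolding lo_def hi_def by auto
    qed auto
    finally have "(hi - lo - 1) * (m * 2 ^ c) - card Y + 2 * m * 2 ^ c \<le> sum cap {u..v}"
      unfolding real_cap zcap .
    moreover have "m * ((hi + 1 - lo) * 2 ^ c) = (hi - lo - 1) * (m * 2 ^ c) + 2 * m * 2 ^ c"
    proof -
      obtain w where "hi = lo + 1 + w" using lohi
        by (metis less_iff_Suc_add add_Suc_right plus_1_eq_Suc add.commute add_Suc)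
      then show ?thesis by (simp add: algebra_simps)
    qed
    ultimately have "card X \<le> sum cap {u..v}" using le by linarith
    then show ?thesis unfolding X_def .
  qed
qed

text \<open>Here \<open>d\<close> is the distance from the cut at level \<open>c\<close> to the
  root. Besides the old discards and the band, at most \<open>3 * m * 2 ^ h / 2 ^ k\<close> jobs are
  lost: twice \<open>m * 2 ^ h / 2 ^ k\<close> on dummy positions and once the same amount in list
  scheduling.\<close>

lemma schedule_top_jobs:
  assumes F: "feasible s rl dl" and c: "consistent rl dl"
    and h: "h = c + d" "k \<le> d" "d \<le> k * K" and D: "D = 2 ^ (k * (2 * K + 1))"
    and sh: "\<And>e q'. c + k \<le> e \<Longrightarrow> e < h \<Longrightarrow> q' div 2 ^ (h - Suc e) = q \<Longrightarrow> short D rl dl e q'"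
    and \<sigma>: "valid rl dl (inside rl dl h q c) \<sigma>"
  shows "\<exists>\<sigma>'. valid rl dl (inside rl dl h q h) \<sigma>' \<and>
     2 ^ k * card (discarded (inside rl dl h q h) \<sigma>') \<le>
     2 ^ k * (card (discarded (inside rl dl h q c) \<sigma>) +
       card (inside rl dl h q (c + k) - inside rl dl h q c)) + 3 * m * 2 ^ h"
proof -
  define Q where "Q = inside rl dl h q c"
  define P where "P = {j \<in> jobs. rl j div 2 ^ h = q \<and> dl j div 2 ^ h = q \<and>
     rl j div 2 ^ (c + k) \<noteq> dl j div 2 ^ (c + k)}"
  define B where "B y = {t::nat. t div 2 ^ c = y}" for y
  define load where "load t = card {j \<in> Q. \<sigma> j = Some t}" for t
  define cap where "cap p = (if odd p then m * 2 ^ c - sum load (B (p div 2))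
     else if 2 ^ k dvd p div 2 then 2 * m * 2 ^ c else 0)" for p
  \<comment> \<open>The odd positions between \<open>a j\<close> and \<open>b j\<close> are exactly
    the blocks strictly between those of \<open>rl j\<close> and \<open>dl j\<close>.\<close>
  define a where "a j = 2 * (rl j div 2 ^ c) + 2" for j
  define b where "b j = 2 * (dl j div 2 ^ c)" for j
  have \<sigma>Q: "valid rl dl Q \<sigma>" using \<sigma> by (simp add: Q_def)
  have Q: "Q \<subseteq> jobs" "\<And>j. j \<in> Q \<Longrightarrow> rl j div 2 ^ c = dl j div 2 ^ c"
    by (auto simp: Q_def inside_def)
  have P: "P \<subseteq> jobs" "\<And>j. j \<in> P \<Longrightarrow> rl j div 2 ^ (c + k) \<noteq> dl j div 2 ^ (c + k)"
    by (auto simp: P_def)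
  have fin: "finite Q" "finite P" using Q(1) P(1) finite_subset by blast+
  have PQ: "j \<notin> Q" if "j \<in> P" for j
    using P(2)[OF that] Q(2) div_power_coarsen[of "rl j" c "dl j" "c + k"] by auto
  have c_rl: "(i, j) \<in> prec \<Longrightarrow> rl i div 2 ^ c \<le> rl j div 2 ^ c"
    and c_dl: "(i, j) \<in> prec \<Longrightarrow> dl i div 2 ^ c \<le> dl j div 2 ^ c" for i j
    using c unfolding consistent_def by (auto intro: div_le_mono)
  have node: "x div 2 ^ c div 2 ^ d = x div 2 ^ h" for x :: nat
    by (simp add: h(1) power_add div_mult2_eq)
  have loadm: "load t \<le> m" for t using \<sigma>Q by (simp add: load_def valid_def)
  obtain idx :: "nat \<Rightarrow> nat" where idx: "inj_on idx jobs" "idx ` jobs = {1..card jobs}"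
      "\<forall>i\<in>jobs. \<forall>j\<in>jobs. (i, j) \<in> prec \<longrightarrow> idx i < idx j"
    using linear_extension[OF _ irrefl_prec trans_prec, of jobs] by auto
  have idxn: "idx j \<le> n" if "j \<in> jobs" for j
    using idx(2) that by (metis atLeastAtMost_iff card_atLeastAtMost diff_Suc_1 imageI)
  \<comment> \<open>Lexicographic order by deadline, then by a linear extension, written in base
    \<open>n + 1\<close>. Since deadlines are monotone along \<open>prec\<close>, so is
    \<open>key\<close>, and the matching then respects precedences weakly.\<close>
  define key where "key j = b j * (n + 1) + idx j" for j
  have key_div: "key j div (n + 1) = b j" if "j \<in> jobs" for j
    unfolding key_def using idxn[OF that] by (intro div_nat_eqI) auto
  have key_mod: "key j mod (n + 1) = idx j" if "j \<in> jobs" for j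
    unfolding key_def mod_mult_self3 using idxn[OF that] by simp
  have key_less: "b i < b j \<or> b i = b j \<and> idx i < idx j"
    if "key i < key j" "i \<in> jobs" "j \<in> jobs" for i j
  proof -
    have "key i div (n + 1) \<le> key j div (n + 1)" using that(1) by (intro div_le_mono) simp
    then have "b i \<le> b j" using that key_div by simp
    then show ?thesis using that(1) by (cases "b i = b j") (auto simp: key_def)
  qed
  have key_inj: "inj_on key P"
  proof (rule inj_onI)
    fix i j
    assume ij: "i \<in> P" "j \<in> P" "key i = key j"
    then have J: "i \<in> jobs" "j \<in> jobs" using P(1) by auto
    have "idx i = idx j" using key_mod[OF J(1)] key_mod[OF J(2)] unfolding ij(3) by (rule trans[OF sym])
    then show "i = j" using inj_onD[OF idx(1) _ J] by blast
  qed
  have b_mono: "b i \<le> b j" if "i \<in> P" "j \<in> P" "key i < key j" for i j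
    using key_less[OF that(3) subsetD[OF P(1) that(1)] subsetD[OF P(1) that(2)]] by linarith
  have b_less: "b j < 0 + (2 * (Suc q * 2 ^ d))" if "j \<in> P" for j
  proof -
    have "dl j div 2 ^ c div 2 ^ d = q" using that node by (simp add: P_def)
    then show ?thesis using div_power_eq_iff[of "dl j div 2 ^ c" d q] by (simp add: b_def)
  qed
  have hall: "card {j \<in> P. u \<le> a j \<and> b j \<le> v} \<le> sum cap {u..v}" for u v
    unfolding a_def b_def
    by (rule top_jobs_hall[OF F c \<sigma>Q Q P load_def]) (simp_all add: cap_def B_def)
  have hall0: "card {j \<in> P. b j \<le> v} \<le> sum cap {0..v}" for v
    using hall[of 0 v] by simp
  obtain x where x: "\<forall>j\<in>P. 0 \<le> x j \<and> a j \<le> x j \<and> x j \<le> b j"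
     "\<forall>y. card {j \<in> P. x j = y} \<le> cap y"
     "\<forall>i\<in>P. \<forall>j\<in>P. a i \<le> a j \<longrightarrow> key i < key j \<longrightarrow> x i \<le> x j"
    using interval_matching_from[OF fin(2) key_inj b_mono b_less hall0 hall] by auto
  have x_mono: "x i \<le> x j" if "i \<in> P" "j \<in> P" "(i, j) \<in> prec" for i j
  proof -
    have ab: "a i \<le> a j" "b i \<le> b j" using c_rl c_dl that(3) by (simp_all add: a_def b_def)
    have "idx i < idx j" using idx(3) that P(1) by blast
    with mult_le_mono1[OF ab(2), of "n + 1"] have "key i < key j"
      unfolding key_def by (rule add_le_less_mono)
    then show ?thesis using x(3) that ab(1) by blast
  qed
  define R where "R y = {j \<in> P. x j = 2 * y + 1}" for y
  have RP: "R y \<subseteq> P" for y by (auto simp: R_def)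
  \<comment> \<open>The first factor \<open>2 ^ (k * K)\<close> is a crude bound on the number of
    levels. In \<open>D\<close> it cancels once; the remaining \<open>2 ^ (k * K)\<close> covers the
    \<open>2 ^ d\<close> blocks, and \<open>2 ^ k\<close> is the ratio wanted for the total
    loss.\<close>
  define \<Delta> where "\<Delta> = 2 ^ (k * K) * 2 ^ h div D"
  have ch: "length xs \<le> \<Delta>" if xs: "chain xs" "set xs \<subseteq> P" for xs
  proof -
    have "D * length xs \<le> (h - (c + k)) * 2 ^ h"
    proof (rule chain_bound[OF _ _ xs(1)])
      show "set xs \<subseteq> {j \<in> jobs. rl j div 2 ^ h = q \<and> dl j div 2 ^ h = q \<and>
          rl j div 2 ^ (c + k) \<noteq> dl j div 2 ^ (c + k)}"
        using xs(2) unfolding P_def .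
    qed (use sh h in auto)
    also have "\<dots> \<le> 2 ^ (k * K) * 2 ^ h"
    proof (rule mult_right_mono)
      have "h - (c + k) < 2 ^ (h - (c + k))" by (rule less_exp)
      also have "\<dots> \<le> 2 ^ (k * K)" using h by (intro power_increasing) auto
      finally show "h - (c + k) \<le> 2 ^ (k * K)" by simp
    qed simp
    finally show ?thesis unfolding \<Delta>_def using D by (simp add: less_eq_div_iff_mult_less_eq mult.commute)
  qed
  have B_ivl: "B y = {y * 2 ^ c..<y * 2 ^ c + 2 ^ c}" for y
    by (auto simp: B_def div_power_eq_iff)
  define block_sched where "block_sched y \<tau> \<longleftrightarrow> (\<forall>j\<in>R y. \<forall>t. \<tau> j = Some t \<longrightarrow> t \<in> B y) \<and>
       (\<forall>t. card {j \<in> R y. \<tau> j = Some t} \<le> m - load t) \<and>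
       (\<forall>i\<in>R y. \<forall>j\<in>R y. \<forall>t u. (i, j) \<in> prec \<longrightarrow> \<tau> i = Some t \<longrightarrow> \<tau> j = Some u \<longrightarrow> t < u) \<and>
       card (discarded (R y) \<tau>) \<le> m * \<Delta>" for y \<tau>
  have ex: "\<exists>\<tau>. block_sched y \<tau>" for y
  proof -
    \<comment> \<open>The matching respects the free capacity of the block, so the overflow term of
      \<open>list_scheduling\<close> vanishes and only \<open>m * \<Delta>\<close> remains.\<close>
    have "card (R y) \<le> cap (2 * y + 1)" using x(2) by (simp add: R_def)
    also have "\<dots> = m * 2 ^ c - sum load (B y)" by (simp add: cap_def)
    also have "\<dots> = (\<Sum>t\<in>B y. m - load t)"
      using loadm by (subst sum_subtractf_nat) (auto simp: B_ivl mult.commute)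
    finally have zero: "card (R y) - (\<Sum>t\<in>{y * 2 ^ c..<y * 2 ^ c + 2 ^ c}. m - load t) = 0"
      unfolding B_ivl by simp
    have finR: "finite (R y)" using fin(2) RP finite_subset by blast
    have chR: "length xs \<le> \<Delta>" if "chain xs" "set xs \<subseteq> R y" for xs
      using ch[OF that(1)] that(2) RP by blast
    show ?thesis
      using list_scheduling[OF finR irrefl_prec trans_prec, of "\<lambda>t. m - load t" m \<Delta> "y * 2 ^ c" "2 ^ c",
          OF diff_le_self chR]
      unfolding zero block_sched_def B_ivl add_0 .
  qed
  define \<tau> where "\<tau> y = (SOME \<tau>. block_sched y \<tau>)" for y
  have "block_sched y (\<tau> y)" for y using someI_ex[OF ex] by (simp only: \<tau>_def)
  then have \<tau>: "j \<in> R y \<Longrightarrow> \<tau> y j = Some t \<Longrightarrow> t \<in> B y"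
    "card {j \<in> R y. \<tau> y j = Some t} \<le> m - load t"
    "i \<in> R y \<Longrightarrow> j \<in> R y \<Longrightarrow> (i, j) \<in> prec \<Longrightarrow> \<tau> y i = Some t \<Longrightarrow>
       \<tau> y j = Some u \<Longrightarrow> t < u"
    "card (discarded (R y) (\<tau> y)) \<le> m * \<Delta>" for y i j t u
    unfolding block_sched_def by blast+
  \<comment> \<open>Bottom jobs keep their times. Band jobs, and top jobs matched to an even
    position, that is a dummy, fall through to \<open>None\<close>.\<close>
  define \<rho> where "\<rho> j = (if j \<in> Q then \<sigma> j
     else if j \<in> P \<and> odd (x j) then \<tau> (x j div 2) j else None)" for j
  have \<rho>Q: "\<rho> j = \<sigma> j" if "j \<in> Q" for j using that by (simp add: \<rho>_def)
  have \<rho>P: "\<exists>y. j \<in> R y \<and> \<tau> y j = Some t \<and> t div 2 ^ c = y \<and>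
      rl j div 2 ^ c < y \<and> y < dl j div 2 ^ c" if j: "j \<notin> Q" "\<rho> j = Some t" for j t
  proof -
    have jP: "j \<in> P" "odd (x j)" and \<tau>j: "\<tau> (x j div 2) j = Some t"
      using j by (auto simp: \<rho>_def split: if_splits)
    then have R: "j \<in> R (x j div 2)" by (auto simp: R_def)
    have "t div 2 ^ c = x j div 2" using \<tau>(1)[OF R \<tau>j] by (simp add: B_def)
    moreover have "rl j div 2 ^ c < x j div 2" "x j div 2 < dl j div 2 ^ c"
      using x(1) jP by (auto simp: a_def b_def elim!: oddE)
    ultimately show ?thesis using R \<tau>j by blast
  qed
  have \<sigma>B: "t div 2 ^ c = rl j div 2 ^ c \<and> t div 2 ^ c = dl j div 2 ^ c"
    if "j \<in> Q" "\<sigma> j = Some t" for j t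
  proof -
    have "rl j \<le> t" "t \<le> dl j" using \<sigma>Q that by (auto simp: valid_def)
    then have "rl j div 2 ^ c \<le> t div 2 ^ c" "t div 2 ^ c \<le> dl j div 2 ^ c"
      by (simp_all add: div_le_mono)
    then show ?thesis using Q(2)[OF that(1)] by simp
  qed
  have div_less: "t < u" if "t div 2 ^ c < u div 2 ^ c" for t u :: nat
    using that div_le_mono[of u t "2 ^ c"] by linarith
  let ?A = "inside rl dl h q h"
  have "valid rl dl ?A \<rho>"
    unfolding valid_def
  proof (intro conjI ballI allI impI)
    fix j t
    assume j: "j \<in> ?A" "\<rho> j = Some t"
    have "rl j \<le> t \<and> t \<le> dl j"
    proof (cases "j \<in> Q")
      case True
      then show ?thesis using \<sigma>Q j \<rho>Q by (auto simp: valid_def)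
    next
      case False
      then have "rl j div 2 ^ c < t div 2 ^ c" "t div 2 ^ c < dl j div 2 ^ c"
        using \<rho>P j by blast+
      then show ?thesis using div_less by (meson less_imp_le)
    qed
    then show "rl j \<le> t" "t \<le> dl j" by auto
  next
    fix t
    have "{j \<in> ?A. \<rho> j = Some t} \<subseteq> {j \<in> Q. \<sigma> j = Some t} \<union>
        {j \<in> R (t div 2 ^ c). \<tau> (t div 2 ^ c) j = Some t}"
      using \<rho>P \<rho>Q by fastforce
    then have "card {j \<in> ?A. \<rho> j = Some t} \<le> card ({j \<in> Q. \<sigma> j = Some t} \<union>
        {j \<in> R (t div 2 ^ c). \<tau> (t div 2 ^ c) j = Some t})"
      using fin by (intro card_mono) (auto simp: R_def)
    also have "\<dots> \<le> load t + (m - load t)"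
      using \<tau>(2)[of "t div 2 ^ c" t] card_Un_le unfolding load_def by (meson add_left_mono le_trans)
    also have "\<dots> = m" using loadm[of t] by simp
    finally show "card {j \<in> ?A. \<rho> j = Some t} \<le> m" .
  next
    fix i j t u
    assume ij: "i \<in> ?A" "j \<in> ?A" "(i, j) \<in> prec" "\<rho> i = Some t" "\<rho> j = Some u"
    show "t < u"
    proof (cases "i \<in> Q"; cases "j \<in> Q")
      assume "i \<in> Q" "j \<in> Q"
      then show ?thesis using \<sigma>Q ij \<rho>Q unfolding valid_def by metis
    next
      \<comment> \<open>A bottom job stays in the block of its window, a top job is strictly inside
        its own window by whole blocks. Weak monotonicity of releases (here) or deadlines (next
        case) therefore puts the two into different blocks in the right order.\<close>
      assume "i \<in> Q" "j \<notin> Q"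
      then have "t div 2 ^ c = rl i div 2 ^ c" "rl j div 2 ^ c < u div 2 ^ c"
        using \<sigma>B \<rho>Q \<rho>P ij by metis+
      then show ?thesis using c_rl[OF ij(3)] div_less[of t u] by linarith
    next
      assume "i \<notin> Q" "j \<in> Q"
      then have "u div 2 ^ c = dl j div 2 ^ c" "t div 2 ^ c < dl i div 2 ^ c"
        using \<sigma>B \<rho>Q \<rho>P ij by metis+
      then show ?thesis using c_dl[OF ij(3)] div_less[of t u] by linarith
    next
      assume "i \<notin> Q" "j \<notin> Q"
      then obtain y z where y: "i \<in> R y" "\<tau> y i = Some t" "t div 2 ^ c = y"
        and z: "j \<in> R z" "\<tau> z j = Some u" "u div 2 ^ c = z" using \<rho>P ij by metis
      then have "x i = 2 * y + 1" "x j = 2 * z + 1" "i \<in> P" "j \<in> P" by (auto simp: R_def)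
      then have "y \<le> z" using x_mono[OF _ _ ij(3)] by fastforce
      then show ?thesis using \<tau>(3)[OF y(1), of j t u] y z ij(3) div_less[of t u]
        by (cases "y = z") auto
    qed
  qed
  moreover have "2 ^ k * card (discarded ?A \<rho>) \<le> 2 ^ k * (card (discarded Q \<sigma>) +
       card (inside rl dl h q (c + k) - Q)) + 3 * m * 2 ^ h"
  proof -
    \<comment> \<open>Dummies with positive capacity sit before the blocks \<open>2 ^ k * w\<close>;
      \<open>2 ^ (d - k)\<close> of these blocks belong to the root interval.\<close>
    let ?W = "{w::nat. w div 2 ^ (d - k) = q}" and ?Y = "{y::nat. y div 2 ^ d = q}"
    let ?ph = "\<Union>w\<in>?W. {j \<in> P. x j = 2 * (2 ^ k * w)}"
    let ?ch = "\<Union>y\<in>?Y. discarded (R y) (\<tau> y)"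
    have "discarded ?A \<rho> \<subseteq> (discarded Q \<sigma> \<union> (inside rl dl h q (c + k) - Q)) \<union> (?ph \<union> ?ch)"
    proof
      fix j
      assume j: "j \<in> discarded ?A \<rho>"
      show "j \<in> (discarded Q \<sigma> \<union> (inside rl dl h q (c + k) - Q)) \<union> (?ph \<union> ?ch)"
      proof (cases "j \<in> Q \<or> j \<in> inside rl dl h q (c + k)")
        case True
        then show ?thesis using j \<rho>Q by auto
      next
        case False
        then have jP: "j \<in> P" "j \<notin> Q" using j by (auto simp: P_def inside_def)
        have ends: "rl j div 2 ^ c div 2 ^ d = q" "dl j div 2 ^ c div 2 ^ d = q"
          using jP by (auto simp: P_def node)
        have bet: "rl j div 2 ^ c < z \<Longrightarrow> z \<le> dl j div 2 ^ c \<Longrightarrow> z div 2 ^ d = q" for z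
          using div_le_mono[of "rl j div 2 ^ c" z "2 ^ d"] div_le_mono[of z "dl j div 2 ^ c" "2 ^ d"] ends
          by simp
        show ?thesis
        proof (cases "odd (x j)")
          case True
          then have R: "j \<in> R (x j div 2)" using jP by (auto simp: R_def)
          moreover have "\<tau> (x j div 2) j = None" using j jP True by (auto simp: \<rho>_def)
          moreover have "x j div 2 div 2 ^ d = q"
            using x(1) jP True by (intro bet) (auto simp: a_def b_def elim!: oddE)
          ultimately show ?thesis by blast
        next
          case False
          then obtain z where z: "x j = 2 * z" by auto
          have "card {j \<in> P. x j = 2 * z} > 0"
            using jP z fin(2) by (auto simp: card_gt_0_iff)
          then have "cap (2 * z) > 0" using x(2) by (meson le_trans not_le)
          then have "2 ^ k dvd z" by (auto simp: cap_def split: if_splits)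
          then obtain w where w: "z = 2 ^ k * w" by auto
          have "z div 2 ^ d = q"
            using x(1) jP(1) z by (intro bet) (auto simp: a_def b_def)
          moreover have "z div 2 ^ d = w div 2 ^ (d - k)"
          proof -
            have "(2::nat) ^ d = 2 ^ k * 2 ^ (d - k)"
              using h(2) by (metis le_add_diff_inverse power_add)
            then show ?thesis using w by (simp add: div_mult2_eq)
          qed
          ultimately show ?thesis using z w jP(1) by auto
        qed
      qed
    qed
    then have "card (discarded ?A \<rho>) \<le>
        card ((discarded Q \<sigma> \<union> (inside rl dl h q (c + k) - Q)) \<union> (?ph \<union> ?ch))"
      using fin by (intro card_mono) (auto simp: finite_inside R_def card_div_power_eq)
    also have "\<dots> \<le> (card (discarded Q \<sigma>) + card (inside rl dl h q (c + k) - Q)) + (card ?ph + card ?ch)"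
      by (meson add_mono card_Un_le le_trans)
    finally have "card (discarded ?A \<rho>) \<le>
       (card (discarded Q \<sigma>) + card (inside rl dl h q (c + k) - Q)) + (card ?ph + card ?ch)" .
    then have "2 ^ k * card (discarded ?A \<rho>) \<le>
       2 ^ k * ((card (discarded Q \<sigma>) + card (inside rl dl h q (c + k) - Q)) + (card ?ph + card ?ch))"
      by (rule mult_le_mono2)
    moreover have "2 ^ k * card ?ph \<le> 2 * m * 2 ^ h"
    proof -
      have "card ?ph \<le> (\<Sum>w\<in>?W. card {j \<in> P. x j = 2 * (2 ^ k * w)})"
        by (intro card_UN_le card_div_power_eq)
      also have "\<dots> \<le> (\<Sum>w\<in>?W. 2 * m * 2 ^ c)"
      proof (rule sum_mono)
        fix w
        show "card {j \<in> P. x j = 2 * (2 ^ k * w)} \<le> 2 * m * 2 ^ c"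
          using x(2)[rule_format, of "2 * (2 ^ k * w)"] by (simp add: cap_def)
      qed
      also have "\<dots> = 2 ^ (d - k) * (2 * m * 2 ^ c)" by (simp add: card_div_power_eq)
      finally have "2 ^ k * card ?ph \<le> 2 ^ k * (2 ^ (d - k) * (2 * m * 2 ^ c))" by (rule mult_le_mono2)
      also have "\<dots> = 2 * m * (2 ^ c * (2 ^ k * 2 ^ (d - k)))" by (simp only: ac_simps)
      also have "\<dots> = 2 * m * 2 ^ h" using h by (simp flip: power_add)
      finally show ?thesis .
    qed
    moreover have "2 ^ k * card ?ch \<le> m * 2 ^ h"
    proof -
      have "card ?ch \<le> (\<Sum>y\<in>?Y. card (discarded (R y) (\<tau> y)))"
        by (intro card_UN_le card_div_power_eq)
      also have "\<dots> \<le> (\<Sum>y\<in>?Y. m * \<Delta>)" using \<tau>(4) by (intro sum_mono)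
      also have "\<dots> = 2 ^ d * (m * \<Delta>)" by (simp add: card_div_power_eq)
      also have "\<dots> \<le> 2 ^ (k * K) * (m * \<Delta>)"
        using h(3) by (intro mult_right_mono power_increasing) auto
      finally have "2 ^ k * card ?ch \<le> 2 ^ k * (2 ^ (k * K) * (m * \<Delta>))" by (rule mult_le_mono2)
      also have "\<dots> = m * (2 ^ k * 2 ^ (k * K) * \<Delta>)" by (simp only: ac_simps)
      also have "\<dots> \<le> m * 2 ^ h"
      proof (rule mult_le_mono2)
        have DD: "D = 2 ^ (k * K) * (2 ^ k * 2 ^ (k * K))"
          unfolding D by (simp add: algebra_simps flip: power_add mult_2)
        have "D * \<Delta> \<le> 2 ^ (k * K) * 2 ^ h" unfolding \<Delta>_def by (rule times_div_less_eq_dividend)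
        then have "2 ^ (k * K) * (2 ^ k * 2 ^ (k * K) * \<Delta>) \<le> 2 ^ (k * K) * 2 ^ h"
          unfolding DD by (simp only: mult.assoc)
        then show "2 ^ k * 2 ^ (k * K) * \<Delta> \<le> 2 ^ h" by simp
      qed
      finally show ?thesis .
    qed
    ultimately show ?thesis unfolding distrib_left by linarith
  qed
  ultimately show ?thesis unfolding Q_def by blast
qed

section \<open>Recursion over the dyadic intervals\<close>

lemma inside_mono: "a \<le> b \<Longrightarrow> inside rl dl h q a \<subseteq> inside rl dl h q b"
  unfolding inside_def by (blast intro: div_power_coarsen)

lemma inside_jobs: "inside rl dl h q c \<subseteq> jobs"
  by (auto simp: inside_def)

lemma refines_inside:
  assumes "refines a rl dl rl' dl'" "a \<le> h" "a \<le> c"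
  shows "inside rl' dl' h q c = inside rl dl h q c"
  using refines_coarsen[OF assms(1,2)] refines_coarsen[OF assms(1,3)]
  unfolding inside_def refines_def by auto

text \<open>Carries a schedule from the private windows of one subtree back to the windows it shares
  with its siblings.\<close>

lemma refines_valid:
  assumes "refines a rl dl rl' dl'" "valid rl' dl' U \<sigma>" "U \<subseteq> jobs"
  shows "valid rl dl U \<sigma>"
  using assms unfolding refines_def valid_def by (meson le_trans subsetD)

text \<open>A window contained in an interval of level \<open>c \<le> h'\<close> lies in exactly one
  child, so children use disjoint jobs and disjoint times. A precedence between different children
  holds because releases are monotone.\<close>

lemma combine_children:
  assumes c: "consistent rl dl" and h: "c \<le> h'"
    and \<sigma>: "\<And>q'. q' div 2 ^ k = q \<Longrightarrow> valid rl dl (inside rl dl h' q' c) (\<sigma> q')"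
  shows "valid rl dl (inside rl dl (h' + k) q c) (\<lambda>j. \<sigma> (rl j div 2 ^ h') j)" (is "valid _ _ ?A ?\<rho>")
    and "card (discarded (inside rl dl (h' + k) q c) (\<lambda>j. \<sigma> (rl j div 2 ^ h') j)) =
      (\<Sum>q' | q' div 2 ^ k = q. card (discarded (inside rl dl h' q' c) (\<sigma> q')))"
    and "card (inside rl dl (h' + k) q c) = (\<Sum>q' | q' div 2 ^ k = q. card (inside rl dl h' q' c))"
proof -
  let ?Q = "{q'::nat. q' div 2 ^ k = q}"
  have split: "x div 2 ^ (h' + k) = x div 2 ^ h' div 2 ^ k" for x :: nat
    by (simp add: power_add div_mult2_eq)
  have A: "j \<in> ?A \<longleftrightarrow> rl j div 2 ^ h' \<in> ?Q \<and> j \<in> inside rl dl h' (rl j div 2 ^ h') c" for j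
  proof
    assume j: "j \<in> ?A"
    then have "rl j div 2 ^ h' = dl j div 2 ^ h'"
      using div_power_coarsen[OF _ h] unfolding inside_def by blast
    then show "rl j div 2 ^ h' \<in> ?Q \<and> j \<in> inside rl dl h' (rl j div 2 ^ h') c"
      using j unfolding inside_def split by simp
  next
    assume "rl j div 2 ^ h' \<in> ?Q \<and> j \<in> inside rl dl h' (rl j div 2 ^ h') c"
    then show "j \<in> ?A" unfolding inside_def split by simp
  qed
  have cell: "q' = rl j div 2 ^ h'" if "j \<in> inside rl dl h' q' c" for j q'
    using that by (auto simp: inside_def)
  have win: "rl j \<le> t" "t \<le> dl j" "t div 2 ^ h' = rl j div 2 ^ h'"
    if "j \<in> ?A" "?\<rho> j = Some t" for j t
  proof -
    have j: "rl j div 2 ^ h' \<in> ?Q" "j \<in> inside rl dl h' (rl j div 2 ^ h') c" using A that(1) by blast+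
    have "valid rl dl (inside rl dl h' (rl j div 2 ^ h') c) (\<sigma> (rl j div 2 ^ h'))"
      using j(1) by (intro \<sigma>) simp
    then show t: "rl j \<le> t" "t \<le> dl j" using j(2) that(2) unfolding valid_def by blast+
    show "t div 2 ^ h' = rl j div 2 ^ h'"
      using div_le_mono[OF t(1), of "2 ^ h'"] div_le_mono[OF t(2), of "2 ^ h'"] j(2)
      by (simp add: inside_def)
  qed
  show "valid rl dl ?A ?\<rho>"
    unfolding valid_def
  proof (intro conjI ballI allI impI)
    fix j t
    assume "j \<in> ?A" "?\<rho> j = Some t"
    then show "rl j \<le> t" "t \<le> dl j" using win by blast+
  next
    fix t
    show "card {j \<in> ?A. ?\<rho> j = Some t} \<le> m"
    proof (cases "{j \<in> ?A. ?\<rho> j = Some t} = {}")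
      case False
      let ?q = "t div 2 ^ h'"
      have sub: "?q \<in> ?Q \<and> j \<in> inside rl dl h' ?q c \<and> \<sigma> ?q j = Some t"
        if "j \<in> ?A" "?\<rho> j = Some t" for j
        using A[of j] that unfolding win(3)[OF that] by blast
      then have "?q \<in> ?Q" using False by blast
      have "{j \<in> ?A. ?\<rho> j = Some t} \<subseteq> {j \<in> inside rl dl h' ?q c. \<sigma> ?q j = Some t}"
        using sub by blast
      then have "card {j \<in> ?A. ?\<rho> j = Some t} \<le> card {j \<in> inside rl dl h' ?q c. \<sigma> ?q j = Some t}"
        by (intro card_mono) (auto simp: finite_inside)
      also have "\<dots> \<le> m" using \<sigma>[of ?q] \<open>?q \<in> ?Q\<close> unfolding valid_def by blast
      finally show ?thesis .
    next
      case True
      show ?thesis unfolding True by simp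
    qed
  next
    fix i j t u
    assume ij: "i \<in> ?A" "j \<in> ?A" "(i, j) \<in> prec" "?\<rho> i = Some t" "?\<rho> j = Some u"
    have "rl i \<le> rl j" using c ij(3) by (auto simp: consistent_def)
    then have le: "rl i div 2 ^ h' \<le> rl j div 2 ^ h'" by (rule div_le_mono)
    show "t < u"
    proof (cases "rl i div 2 ^ h' = rl j div 2 ^ h'")
      case True
      have Q: "rl j div 2 ^ h' \<in> ?Q" "j \<in> inside rl dl h' (rl j div 2 ^ h') c"
        "i \<in> inside rl dl h' (rl j div 2 ^ h') c" using A[of j] A[of i] ij(1,2) unfolding True by blast+
      have "valid rl dl (inside rl dl h' (rl j div 2 ^ h') c) (\<sigma> (rl j div 2 ^ h'))"
        using \<sigma> Q(1) by simp
      then show ?thesis using Q(2,3) ij(3) ij(4)[unfolded True] ij(5) unfolding valid_def by blast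
    next
      case False
      then have "t div 2 ^ h' < u div 2 ^ h'" using le win(3)[OF ij(1,4)] win(3)[OF ij(2,5)] by linarith
      then show ?thesis using div_le_mono[of u t "2 ^ h'"] by linarith
    qed
  qed
  have "discarded ?A ?\<rho> = (\<Union>q'\<in>?Q. discarded (inside rl dl h' q' c) (\<sigma> q'))"
  proof (intro set_eqI iffI)
    fix j
    assume "j \<in> discarded ?A ?\<rho>"
    then show "j \<in> (\<Union>q'\<in>?Q. discarded (inside rl dl h' q' c) (\<sigma> q'))" using A by blast
  next
    fix j
    assume "j \<in> (\<Union>q'\<in>?Q. discarded (inside rl dl h' q' c) (\<sigma> q'))"
    then obtain q' where "q' \<in> ?Q" "j \<in> inside rl dl h' q' c" "\<sigma> q' j = None" by blast
    moreover from this have "q' = rl j div 2 ^ h'" using cell by blast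
    ultimately show "j \<in> discarded ?A ?\<rho>" using A[of j] by blast
  qed
  moreover have "card (\<Union>q'\<in>?Q. discarded (inside rl dl h' q' c) (\<sigma> q')) =
      (\<Sum>q'\<in>?Q. card (discarded (inside rl dl h' q' c) (\<sigma> q')))"
    by (rule card_UN_disjoint) (use cell in \<open>auto simp: card_div_power_eq finite_inside\<close>)
  ultimately show "card (discarded ?A ?\<rho>) = (\<Sum>q'\<in>?Q. card (discarded (inside rl dl h' q' c) (\<sigma> q')))"
    by simp
  have "?A = (\<Union>q'\<in>?Q. inside rl dl h' q' c)"
    using A cell by blast
  moreover have "card (\<Union>q'\<in>?Q. inside rl dl h' q' c) = (\<Sum>q'\<in>?Q. card (inside rl dl h' q' c))"
    by (rule card_UN_disjoint) (use cell in \<open>auto simp: card_div_power_eq finite_inside\<close>)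
  ultimately show "card ?A = (\<Sum>q'\<in>?Q. card (inside rl dl h' q' c))" by simp
qed

text \<open>A single job is a chain of length 1, too long for any node below the root once
  \<open>D > 2 ^ h\<close>. So no node owns a job, every window is one point, and the LP is integral
  there.\<close>

lemma leaf_schedule:
  assumes F: "feasible s rl dl" and c: "consistent rl dl"
    and D: "2 ^ h < D"
    and sh: "\<And>e q'. e < h \<Longrightarrow> q' div 2 ^ (h - Suc e) = q \<Longrightarrow> short D rl dl e q'"
    and U: "U \<subseteq> inside rl dl h q h"
  shows "valid rl dl U (\<lambda>j. Some (rl j))"
proof -
  have eq: "rl j = dl j" if "j \<in> U" for j
  proof (rule ccontr)
    assume ne: "rl j \<noteq> dl j"
    have "j \<in> inside rl dl h q h" using that U by blast
    then have j: "j \<in> jobs" "rl j div 2 ^ h = q" "dl j div 2 ^ h = q" by (auto simp: inside_def)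
    from owner_exists[of j rl h q dl 0, OF j] ne obtain e q' where e: "e < h" "q' div 2 ^ (h - Suc e) = q"
      "j \<in> owned rl dl e q'" by auto
    have "D * length [j] \<le> 2 ^ Suc e"
      using sh[OF e(1,2)] e(3) unfolding short_def
      by (metis empty_set insert_subset empty_subsetI list.simps(15) sorted_wrt1)
    also have "\<dots> \<le> (2::nat) ^ h" using e(1) by (intro power_increasing) auto
    finally show False using D by simp
  qed
  have UJ: "U \<subseteq> jobs" using U inside_jobs by blast
  have "card {j \<in> U. Some (rl j) = Some t} \<le> m" for t
  proof -
    have "card {j \<in> U. Some (rl j) = Some t} \<le> card {j \<in> jobs. t \<le> rl j \<and> dl j \<le> t}"
    proof (rule card_mono)
      show "{j \<in> U. Some (rl j) = Some t} \<subseteq> {j \<in> jobs. t \<le> rl j \<and> dl j \<le> t}"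
        using eq UJ by auto
    qed simp
    also have "\<dots> \<le> m * (t + 1 - t)" by (rule window_feasible_hall[OF F])
    finally show ?thesis by simp
  qed
  moreover have "rl i < rl j" if "i \<in> U" "j \<in> U" "(i, j) \<in> prec" for i j
  proof -
    have "rl i \<noteq> rl j"
      using window_feasible_singletons[OF F that(3)] that eq UJ by blast
    moreover have "rl i \<le> rl j" using c that(3) by (auto simp: consistent_def)
    ultimately show ?thesis by simp
  qed
  ultimately show ?thesis using eq unfolding valid_def by auto
qed

text \<open>
  The schedule \<open>\<sigma> i\<close> is the one whose next cut is \<open>k * i\<close> levels below the root of the subtree; the jobs
  above this cut are left to the ancestors.
\<close>

lemma offset_schedules:
  assumes k: "k \<ge> 1" and K: "K \<ge> 1" and D: "D = 2 ^ (k * (2 * K + 1))"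
    and R: "R = 2 ^ (k * K) * (2 * D * m)"
    and F: "feasible (h * R) rl dl" and c: "consistent rl dl"
    and sh: "\<And>e q'. h - k * K \<le> e \<Longrightarrow> e < h \<Longrightarrow> q' div 2 ^ (h - Suc e) = q \<Longrightarrow> short D rl dl e q'"
  shows "\<exists>\<sigma>. (\<forall>i<K. valid rl dl (inside rl dl h q (h - k * i)) (\<sigma> i)) \<and>
     2 ^ k * (\<Sum>i<K. card (discarded (inside rl dl h q (h - k * i)) (\<sigma> i))) \<le>
     2 ^ k * card (inside rl dl h q (h - k * (K - 1))) + 3 * m * h * 2 ^ h"
  using F c sh
proof (induction h arbitrary: rl dl q rule: less_induct)
  case (less h)
  note c = less.prems(2) and sh = less.prems(3)
  show ?case
  proof (cases "h < k * K")
    case True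
    have "(2::nat) ^ h < 2 ^ (k * K)" using True by (intro power_strict_increasing) auto
    also have "\<dots> \<le> D" unfolding D by (intro power_increasing) auto
    finally have "valid rl dl (inside rl dl h q (h - k * i)) (\<lambda>j. Some (rl j))" for i
      using True sh inside_mono[of "h - k * i" h rl dl h q]
      by (intro leaf_schedule[OF less.prems(1) c]) auto
    then show ?thesis by (intro exI[of _ "\<lambda>_ j. Some (rl j)"]) simp
  next
    case False
    define h' where "h' = h - k"
    define c0 where "c0 = h - k * K"
    obtain K' where K': "K = Suc K'" using K by (cases K) auto
    have kK: "k \<le> k * K" using K by simp
    have hh: "h = h' + k" "h = c0 + k * K" "c0 \<le> h'" "h' < h" "c0 + k * K' = h'"
      using False kK k unfolding h'_def c0_def K' by auto
    have step: "\<exists>\<sigma>. (\<forall>i<K. valid rl dl (inside rl dl h' q' (h' - k * i)) (\<sigma> i)) \<and>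
       2 ^ k * (\<Sum>i<K. card (discarded (inside rl dl h' q' (h' - k * i)) (\<sigma> i))) \<le>
       2 ^ k * card (inside rl dl h' q' c0) + 3 * m * h' * 2 ^ h'"
      if q': "q' div 2 ^ k = q" for q'
    proof -
      \<comment> \<open>The levels from \<open>c0\<close> on are short by assumption and stay so.
        Only the \<open>k\<close> levels from \<open>?c\<close> up to \<open>c0\<close> are new, and
        one portion \<open>R\<close> of the rounds pays for them in every child separately.\<close>
      let ?c = "h' - k * K"
      have "h' * R + 2 ^ (h' - ?c) * (2 * D * m) \<le> h' * R + R"
        unfolding R by (intro add_left_mono mult_right_mono power_increasing) auto
      also have "\<dots> = Suc h' * R" by simp
      also have "\<dots> \<le> h * R" using hh(4) by (intro mult_right_mono) auto
      finally have "feasible (h' * R + 2 ^ (h' - ?c) * (2 * D * m)) rl dl"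
        by (rule feasible_mono[OF less.prems(1)])
      moreover have "?c \<le> c0" using hh by simp
      ultimately obtain rl' dl' where F': "feasible (h' * R) rl' dl'" and r: "refines c0 rl dl rl' dl'"
        and sh': "\<And>e q''. ?c \<le> e \<Longrightarrow> e < c0 \<Longrightarrow> q'' div 2 ^ (h' - Suc e) = q' \<Longrightarrow> short D rl' dl' e q''"
        using process_levels[of ?c c0 h' "h' * R" D rl dl q'] c hh(3) by blast
      have c': "consistent rl' dl'" using r by (simp add: refines_def)
      have "short D rl' dl' e q''" if e: "?c \<le> e" "e < h'" "q'' div 2 ^ (h' - Suc e) = q'" for e q''
      proof (cases "e < c0")
        case True
        then show ?thesis using sh' e by blast
      next
        case False
        have "h - Suc e = (h' - Suc e) + k" using e(2) hh(1) by simp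
        then have "q'' div 2 ^ (h - Suc e) = q"
          using e(3) q' by (simp add: power_add div_mult2_eq)
        then show ?thesis
          using sh[of e q''] refines_short[OF r, of e D q''] False e(2) hh(4) c0_def by simp
      qed
      from less.IH[OF hh(4) F' c' this] obtain \<sigma> where
        \<sigma>: "\<forall>i<K. valid rl' dl' (inside rl' dl' h' q' (h' - k * i)) (\<sigma> i)"
        "2 ^ k * (\<Sum>i<K. card (discarded (inside rl' dl' h' q' (h' - k * i)) (\<sigma> i))) \<le>
         2 ^ k * card (inside rl' dl' h' q' (h' - k * (K - 1))) + 3 * m * h' * 2 ^ h'" by blast
      have ge: "c0 \<le> h' - k * i" if "i < K" for i
      proof -
        have "k * i \<le> k * K'" using that K' by simp
        then show ?thesis using hh(5) by linarith
      qed
      have ins: "inside rl' dl' h' q' (h' - k * i) = inside rl dl h' q' (h' - k * i)" if "i < K" for i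
        using refines_inside[OF r hh(3) ge[OF that]] .
      have "valid rl dl (inside rl dl h' q' (h' - k * i)) (\<sigma> i)" if "i < K" for i
        using refines_valid[OF r] \<sigma>(1) that ins inside_jobs by metis
      moreover have "h' - k * (K - 1) = c0" using hh(5) K' by simp
      ultimately show ?thesis using \<sigma>(2) ins[of "K - 1"] K by (intro exI[of _ \<sigma>]) (simp add: ins)
    qed
    define good where "good q' \<sigma> \<longleftrightarrow> (\<forall>i<K. valid rl dl (inside rl dl h' q' (h' - k * i)) (\<sigma> i)) \<and>
       2 ^ k * (\<Sum>i<K. card (discarded (inside rl dl h' q' (h' - k * i)) (\<sigma> i))) \<le>
       2 ^ k * card (inside rl dl h' q' c0) + 3 * m * h' * 2 ^ h'" for q' and \<sigma> :: "nat \<Rightarrow> nat \<Rightarrow> nat option"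
    define s where "s q' = (SOME \<sigma>. good q' \<sigma>)" for q'
    have good: "good q' (s q')" if "q' div 2 ^ k = q" for q'
    proof -
      have "\<exists>\<sigma>. good q' \<sigma>" using step[OF that] unfolding good_def .
      then show ?thesis unfolding s_def by (rule someI_ex)
    qed
    let ?Q = "{q'::nat. q' div 2 ^ k = q}"
    define \<rho> where "\<rho> i j = s (rl j div 2 ^ h') i j" for i j
    let ?A = "\<lambda>c. inside rl dl h q c"
    have comb: "valid rl dl (?A (h' - k * i)) (\<rho> i)"
      "card (discarded (?A (h' - k * i)) (\<rho> i)) =
        (\<Sum>q'\<in>?Q. card (discarded (inside rl dl h' q' (h' - k * i)) (s q' i)))" if "i < K" for i
    proof -
      have *: "valid rl dl (inside rl dl h' q' (h' - k * i)) (s q' i)" if "q' div 2 ^ k = q" for q'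
        using good[OF that] \<open>i < K\<close> by (simp add: good_def)
      then show "valid rl dl (?A (h' - k * i)) (\<rho> i)"
        unfolding \<rho>_def[abs_def] hh(1) by (rule combine_children(1)[OF c diff_le_self])
      show "card (discarded (?A (h' - k * i)) (\<rho> i)) =
          (\<Sum>q'\<in>?Q. card (discarded (inside rl dl h' q' (h' - k * i)) (s q' i)))"
        unfolding \<rho>_def[abs_def] hh(1) by (rule combine_children(2)[OF c diff_le_self *])
    qed
    have cardA: "card (?A c0) = (\<Sum>q'\<in>?Q. card (inside rl dl h' q' c0))"
    proof -
      have "valid rl dl (inside rl dl h' q' c0) (\<lambda>_. None)" for q' by (simp add: valid_def)
      then show ?thesis unfolding hh(1) by (rule combine_children(3)[OF c hh(3)])
    qed
    \<comment> \<open>The last offset of the children cuts at \<open>c0\<close>, which is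
      \<open>k * K\<close> levels below the present root; filling the gap above it gives the
      schedule for offset 0.\<close>
    have "valid rl dl (?A c0) (\<rho> K')" using comb(1)[of K'] hh(5) K' by (metis add_diff_cancel_right' lessI)
    from schedule_top_jobs[OF less.prems(1) c hh(2) kK le_refl D _ this] sh
    obtain \<sigma>0 where \<sigma>0: "valid rl dl (?A h) \<sigma>0"
      "2 ^ k * card (discarded (?A h) \<sigma>0) \<le>
       2 ^ k * (card (discarded (?A c0) (\<rho> K')) + card (?A (c0 + k) - ?A c0)) + 3 * m * 2 ^ h"
      unfolding c0_def by (metis (no_types, lifting) add_leD1)
    \<comment> \<open>Seen from the present root, every cut of the children is \<open>k\<close>
      levels deeper, so the offsets rotate by one.\<close>
    define \<sigma> where "\<sigma> i = (case i of 0 \<Rightarrow> \<sigma>0 | Suc i \<Rightarrow> \<rho> i)" for i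
    have shift: "h - k * Suc i = h' - k * i" for i using hh(1) by simp
    have sch: "valid rl dl (?A (h - k * i)) (\<sigma> i)" if "i < K" for i
    proof (cases i)
      case 0
      then show ?thesis using \<sigma>0(1) by (simp add: \<sigma>_def)
    next
      case (Suc i')
      then show ?thesis using comb(1)[of i'] that unfolding Suc shift by (simp add: \<sigma>_def)
    qed
    let ?S = "\<Sum>i<K. card (discarded (?A (h' - k * i)) (\<rho> i))"
    have "(\<Sum>i<K. card (discarded (?A (h - k * i)) (\<sigma> i))) =
        card (discarded (?A h) \<sigma>0) + (\<Sum>i<K'. card (discarded (?A (h' - k * i)) (\<rho> i)))"
      unfolding K' sum.lessThan_Suc_shift shift by (simp add: \<sigma>_def)
    then have "2 ^ k * (\<Sum>i<K. card (discarded (?A (h - k * i)) (\<sigma> i))) =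
        2 ^ k * card (discarded (?A h) \<sigma>0) + 2 ^ k * (\<Sum>i<K'. card (discarded (?A (h' - k * i)) (\<rho> i)))"
      by (simp add: distrib_left)
    also have "\<dots> \<le> 2 ^ k * ?S + 2 ^ k * card (?A (c0 + k) - ?A c0) + 3 * m * 2 ^ h"
    proof -
      have "h' - k * K' = c0" using hh(5) by simp
      then have "?S = (\<Sum>i<K'. card (discarded (?A (h' - k * i)) (\<rho> i))) + card (discarded (?A c0) (\<rho> K'))"
        unfolding K' by simp
      then show ?thesis using \<sigma>0(2) by (simp add: distrib_left)
    qed
    also have "2 ^ k * ?S \<le> 2 ^ k * card (?A c0) + 3 * m * h' * 2 ^ h"
    proof -
      have "?S = (\<Sum>i<K. \<Sum>q'\<in>?Q. card (discarded (inside rl dl h' q' (h' - k * i)) (s q' i)))"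
        using comb(2) by simp
      also have "\<dots> = (\<Sum>q'\<in>?Q. \<Sum>i<K. card (discarded (inside rl dl h' q' (h' - k * i)) (s q' i)))"
        by (rule sum.swap)
      finally have "2 ^ k * ?S =
          (\<Sum>q'\<in>?Q. 2 ^ k * (\<Sum>i<K. card (discarded (inside rl dl h' q' (h' - k * i)) (s q' i))))"
        by (simp only: sum_distrib_left)
      also have "\<dots> \<le> (\<Sum>q'\<in>?Q. 2 ^ k * card (inside rl dl h' q' c0) + 3 * m * h' * 2 ^ h')"
        using good by (intro sum_mono) (simp add: good_def)
      also have "\<dots> = 2 ^ k * card (?A c0) + 2 ^ k * (3 * m * h' * 2 ^ h')"
        by (simp add: sum.distrib cardA sum_distrib_left card_div_power_eq)
      also have "2 ^ k * (3 * m * h' * 2 ^ h') = 3 * m * h' * 2 ^ h"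
        unfolding hh(1) power_add by (simp only: ac_simps)
      finally show ?thesis .
    qed
    finally have "2 ^ k * (\<Sum>i<K. card (discarded (?A (h - k * i)) (\<sigma> i))) \<le>
       2 ^ k * (card (?A c0) + card (?A (c0 + k) - ?A c0)) + (3 * m * h' * 2 ^ h + 3 * m * 2 ^ h)"
      by (simp add: distrib_left)
    \<comment> \<open>The band just discarded sits directly above the jobs already charged, so over
      all offsets together each job is charged as a band job at most once.\<close>
    also have "card (?A c0) + card (?A (c0 + k) - ?A c0) = card (?A (c0 + k))"
      using inside_mono[of c0 "c0 + k" rl dl h q] finite_inside
      by (metis card_Diff_subset card_mono finite_subset le_add1 le_add_diff_inverse)
    also have "c0 + k = h - k * (K - 1)" using hh(1,5) K' by simp
    also have "3 * m * h' * 2 ^ h + 3 * m * 2 ^ h = 3 * m * Suc h' * 2 ^ h" by (simp add: algebra_simps)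
    also have "\<dots> \<le> 3 * m * h * 2 ^ h" using hh(4) by (intro mult_right_mono mult_left_mono) auto
    finally show ?thesis using sch by (intro exI[of _ \<sigma>]) simp
  qed
qed

text \<open>For each of the \<open>K\<close> offsets the gap between the topmost cut and the root is
  filled. Summed over offsets, bands cost at most \<open>n\<close> and insertions at most
  \<open>3 * m * (h + K) * 2 ^ h / 2 ^ k\<close>; the best offset is no worse than the average. The
  additional \<open>R\<close> rounds make the topmost \<open>k * K\<close> levels short.\<close>

lemma schedule_exists:
  assumes k: "k \<ge> 1" and K: "K \<ge> 1" and D: "D = 2 ^ (k * (2 * K + 1))"
    and R: "R = 2 ^ (k * K) * (2 * D * m)"
    and F: "feasible (h * R + R) (\<lambda>_. 1) (\<lambda>_. T)" and T: "1 \<le> T" "T < 2 ^ h"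
  shows "\<exists>\<sigma>. valid (\<lambda>_. 1) (\<lambda>_. T) jobs \<sigma> \<and>
     K * (2 ^ k * card (discarded jobs \<sigma>)) \<le> 2 ^ k * n + 3 * m * (h + K) * 2 ^ h"
proof -
  have c1: "consistent (\<lambda>_. 1) (\<lambda>_. T)" using T by (simp add: consistent_def)
  let ?c = "h - k * K"
  have "h * R + 2 ^ (h - ?c) * (2 * D * m) \<le> h * R + R"
    unfolding R by (intro add_left_mono mult_right_mono power_increasing) auto
  then have "feasible (h * R + 2 ^ (h - ?c) * (2 * D * m)) (\<lambda>_. 1) (\<lambda>_. T)"
    by (rule feasible_mono[OF F])
  then obtain rl dl where F': "feasible (h * R) rl dl" and r: "refines h (\<lambda>_. 1) (\<lambda>_. T) rl dl"
    and sh: "\<And>e q'. ?c \<le> e \<Longrightarrow> e < h \<Longrightarrow> q' div 2 ^ (h - Suc e) = 0 \<Longrightarrow> short D rl dl e q'"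
    using process_levels[of ?c h h "h * R" D "\<lambda>_. 1" "\<lambda>_. T" 0] c1 by auto
  have c: "consistent rl dl" using r by (simp add: refines_def)
  let ?A = "\<lambda>c. inside rl dl h 0 c"
  have top: "?A h = jobs"
  proof -
    have "rl j div 2 ^ h = 0" "dl j div 2 ^ h = 0" if "j \<in> jobs" for j
      using r that T unfolding refines_def by auto
    then show ?thesis unfolding inside_def by auto
  qed
  show ?thesis
  proof (cases "h < k * K")
    case True
    have "(2::nat) ^ h < 2 ^ (k * K)" using True by (intro power_strict_increasing) auto
    also have "\<dots> \<le> D" unfolding D by (intro power_increasing) auto
    finally have "valid rl dl jobs (\<lambda>j. Some (rl j))"
      using True sh top by (intro leaf_schedule[OF F' c, of h D 0]) auto
    then show ?thesis
      using refines_valid[OF r] by (intro exI[of _ "\<lambda>j. Some (rl j)"]) auto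
  next
    case False
    obtain \<sigma> where \<sigma>: "\<And>i. i < K \<Longrightarrow> valid rl dl (?A (h - k * i)) (\<sigma> i)"
     "2 ^ k * (\<Sum>i<K. card (discarded (?A (h - k * i)) (\<sigma> i))) \<le>
       2 ^ k * card (?A (h - k * (K - 1))) + 3 * m * h * 2 ^ h"
      using offset_schedules[OF k K D R F' c sh] by blast
    define band where "band i = card (?A (h - k * i + k) - ?A (h - k * i))" for i
    define good where "good i \<rho> \<longleftrightarrow> valid rl dl jobs \<rho> \<and> 2 ^ k * card (discarded jobs \<rho>) \<le>
        2 ^ k * (card (discarded (?A (h - k * i)) (\<sigma> i)) + band i) + 3 * m * 2 ^ h" for i \<rho>
    have ex: "\<exists>\<rho>. good i \<rho>" if "i < K" for i
    \<comment> \<open>For offset 0 the cut is at the root, and the recursion already delivers a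
      schedule of all jobs.\<close>
    proof (cases "i = 0")
      case True
      then show ?thesis using \<sigma>(1)[OF that] top
        unfolding good_def by (intro exI[of _ "\<sigma> 0"]) (simp add: distrib_left)
    next
      case i: False
      have "k * i \<le> k * K" using that by simp
      then have "k * i \<le> h" using False by linarith
      then have h: "h = (h - k * i) + k * i" by simp
      have "?c \<le> h - k * i + k" using diff_le_mono2[OF \<open>k * i \<le> k * K\<close>, of h] by linarith
      then have shi: "short D rl dl e q'"
        if "h - k * i + k \<le> e" "e < h" "q' div 2 ^ (h - Suc e) = 0" for e q'
        using sh that le_trans by blast
      have "k \<le> k * i" using i by simp
      from schedule_top_jobs[OF F' c h this \<open>k * i \<le> k * K\<close> D shi \<sigma>(1)[OF that]]
      show ?thesis unfolding top good_def band_def .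
    qed
    define \<rho> where "\<rho> i = (SOME \<rho>. good i \<rho>)" for i
    have "good i (\<rho> i)" if "i < K" for i
      unfolding \<rho>_def using ex[OF that] by (rule someI_ex)
    then have \<rho>: "valid rl dl jobs (\<rho> i)"
      "2 ^ k * card (discarded jobs (\<rho> i)) \<le>
        2 ^ k * (card (discarded (?A (h - k * i)) (\<sigma> i)) + band i) + 3 * m * 2 ^ h" if "i < K" for i
      using that unfolding good_def by blast+
    \<comment> \<open>The bands at the topmost cuts are disjoint from each other and from the jobs
      below the last cut; band 0 is empty, as all jobs lie inside the root.\<close>
    have bands: "(\<Sum>i<l. band i) + card (?A (h - k * (l - 1))) \<le> n" if "1 \<le> l" "l \<le> K" for l
      using that
    proof (induction l rule: dec_induct)
      case base
      have e: "?A (h + k) - ?A h = {}" unfolding top inside_def by auto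
      have "band 0 = 0" unfolding band_def mult_0_right diff_zero e by simp
      then show ?case using top by simp
    next
      case (step l)
      have "k * l \<le> k * K" using step.prems by (intro mult_le_mono2) simp
      then have "k * l \<le> h" using False by linarith
      moreover have "k * l = k * (l - 1) + k" using step.hyps by (cases l) auto
      ultimately have e: "h - k * l + k = h - k * (l - 1)" by simp
      have "card (?A (h - k * l)) + band l = card (?A (h - k * (l - 1)))"
        unfolding band_def e
        using inside_mono[of "h - k * l" "h - k * (l - 1)" rl dl h 0] finite_inside
        by (metis card_Diff_subset card_mono diff_le_mono2 diff_le_self finite_subset le_add_diff_inverse mult_le_mono2)
      then show ?case using step.IH step.prems by simp
    qed
    have "2 ^ k * (\<Sum>i<K. card (discarded jobs (\<rho> i))) = (\<Sum>i<K. 2 ^ k * card (discarded jobs (\<rho> i)))"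
      by (simp only: sum_distrib_left)
    also have "\<dots> \<le> (\<Sum>i<K. 2 ^ k * (card (discarded (?A (h - k * i)) (\<sigma> i)) + band i) + 3 * m * 2 ^ h)"
      using \<rho>(2) by (intro sum_mono) simp
    also have "\<dots> = 2 ^ k * (\<Sum>i<K. card (discarded (?A (h - k * i)) (\<sigma> i))) +
        2 ^ k * (\<Sum>i<K. band i) + K * (3 * m * 2 ^ h)"
      by (simp add: sum.distrib distrib_left sum_distrib_left)
    also have "\<dots> \<le> 2 ^ k * ((\<Sum>i<K. band i) + card (?A (h - k * (K - 1)))) +
        3 * m * h * 2 ^ h + K * (3 * m * 2 ^ h)"
      using \<sigma>(2) by (simp add: distrib_left)
    also have "\<dots> \<le> 2 ^ k * n + 3 * m * h * 2 ^ h + K * (3 * m * 2 ^ h)"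
      using bands[OF K le_refl] by (intro add_right_mono mult_le_mono2)
    also have "\<dots> = 2 ^ k * n + 3 * m * (h + K) * 2 ^ h" by (simp add: algebra_simps)
    finally have total: "2 ^ k * (\<Sum>i<K. card (discarded jobs (\<rho> i))) \<le> 2 ^ k * n + 3 * m * (h + K) * 2 ^ h" .
    obtain i where i: "i < K" "\<And>i'. i' < K \<Longrightarrow> card (discarded jobs (\<rho> i)) \<le> card (discarded jobs (\<rho> i'))"
      using ex_has_least_nat[of "\<lambda>i. i < K" 0 "\<lambda>i. card (discarded jobs (\<rho> i))"] K by auto
    have "K * card (discarded jobs (\<rho> i)) = (\<Sum>i'<K. card (discarded jobs (\<rho> i)))" by simp
    also have "\<dots> \<le> (\<Sum>i'<K. card (discarded jobs (\<rho> i')))" using i(2) by (intro sum_mono) simp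
    finally have "2 ^ k * (K * card (discarded jobs (\<rho> i))) \<le> 2 ^ k * n + 3 * m * (h + K) * 2 ^ h"
      using total by (meson le_trans mult_le_mono2)
    then have "K * (2 ^ k * card (discarded jobs (\<rho> i))) \<le> 2 ^ k * n + 3 * m * (h + K) * 2 ^ h"
      by (simp only: ac_simps)
    then show ?thesis using refines_valid[OF r \<rho>(1)[OF i(1)]] by blast
  qed
qed

end

section \<open>The number of rounds\<close>

text \<open>One job per time in the order of a linear extension. Settling this case leaves
  \<open>T < n\<close>, so that the number of levels, and with it the number of rounds, is bounded
  in terms of \<open>n\<close>.\<close>

lemma schedule_if_horizon_large:
  assumes prec: "precedence_order n prec" and "n \<le> T" "m \<ge> 1"
  shows "\<exists>\<sigma>. partial_feasible_schedule m n prec T \<sigma> \<and> {j \<in> {1..n}. \<sigma> j = None} = {}"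
proof -
  have po: "irrefl prec" "trans prec" and sub: "prec \<subseteq> {1..n} \<times> {1..n}"
    using prec by (auto simp: precedence_order_def)
  obtain f :: "nat \<Rightarrow> nat" where f: "inj_on f {1..n}" "f ` {1..n} = {1..card {1..n}}"
      "\<forall>i\<in>{1..n}. \<forall>j\<in>{1..n}. (i, j) \<in> prec \<longrightarrow> f i < f j"
    using linear_extension[OF finite_atLeastAtMost po, of 1 n] by (elim exE conjE) (rule that)
  have "card {j \<in> {1..n}. f j = t} \<le> m" for t
  proof -
    have "card {j \<in> {1..n}. f j = t} \<le> card {t}"
      by (rule card_inj_on_le[OF inj_on_subset[OF f(1)]]) auto
    then show ?thesis using assms(3) by simp
  qed
  moreover have "f j \<in> {1..T}" if "j \<in> {1..n}" for j
  proof -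
    have "f j \<in> {1..card {1..n}}" using f(2) that by blast
    then show ?thesis using assms(2) by simp
  qed
  moreover have "f i < f j" if "(i, j) \<in> prec" for i j using f(3) sub that by blast
  ultimately have "partial_feasible_schedule m n prec T (\<lambda>j. Some (f j))"
    unfolding partial_feasible_schedule_def by simp
  then show ?thesis by (intro exI[of _ "\<lambda>j. Some (f j)"]) simp
qed

lemma window_feasible_trivial:
  assumes "sherali_adams (time_indexed_vars n T) (time_indexed_lp m n prec T) s \<noteq> {}"
  shows "window_feasible m n prec T s (\<lambda>_. 1) (\<lambda>_. T)"
  using assms unfolding window_feasible_def by auto

lemma n_le_capacity:
  assumes "sherali_adams (time_indexed_vars n T) (time_indexed_lp m n prec T) s \<noteq> {}"
  shows "n \<le> m * T"
proof -
  have "{j \<in> {1..n}. (1::nat) \<le> 1 \<and> T \<le> T} = {1..n}" by auto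
  then show ?thesis using window_feasible_hall[OF window_feasible_trivial[OF assms], of 1 T] by simp
qed

lemma power_scale:
  fixes x :: real
  assumes "x \<ge> 1"
  shows "\<exists>k. k \<ge> 1 \<and> x \<le> 2 ^ k \<and> 2 ^ k \<le> 2 * x"
proof -
  obtain i where i: "real (2 ^ i) \<le> x" "x < real (2 ^ Suc i)"
  proof -
    define i where "i = nat \<lfloor>log 2 x\<rfloor>"
    have l: "0 \<le> \<lfloor>log 2 x\<rfloor>" using assms by simp
    then have "real i \<le> log 2 x" "log 2 x < real (Suc i)" unfolding i_def by linarith+
    then have "2 powr real i \<le> x" "x < 2 powr real (Suc i)"
      using assms by (simp_all add: le_log_iff log_less_iff)
    then show ?thesis using that[of i] by (simp only: powr_realpow of_nat_power of_nat_numeral zero_less_numeral)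
  qed
  then show ?thesis by (intro exI[of _ "Suc i"]) auto
qed

lemma schedule_few_discarded:
  fixes \<epsilon> :: real
  assumes prec: "precedence_order n prec" and m: "m \<ge> 1" and \<epsilon>: "\<epsilon> > 0"
    and K: "real K \<ge> 2 * real m / \<epsilon>" "K \<ge> 1" and k: "k \<ge> 1" "2 ^ k \<ge> 12 * real m * (log 2 n + 2) / \<epsilon>"
    and H: "real H \<ge> log 2 n + 2" and r: "r \<ge> H * (2 ^ (k * K) * (2 * 2 ^ (k * (2 * K + 1)) * m))"
    and SA: "sherali_adams (time_indexed_vars n T) (time_indexed_lp m n prec T) r \<noteq> {}"
  shows "\<exists>\<sigma>. partial_feasible_schedule m n prec T \<sigma> \<and>
     real (card {j \<in> {1..n}. \<sigma> j = None}) \<le> \<epsilon> * real T"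
proof (cases "n \<le> T")
  case True
  then obtain \<sigma> where "partial_feasible_schedule m n prec T \<sigma>" "{j \<in> {1..n}. \<sigma> j = None} = {}"
    using schedule_if_horizon_large[OF prec _ m] by blast
  then show ?thesis using \<epsilon> by (intro exI[of _ \<sigma>]) (simp only: card.empty, simp)
next
  case False
  interpret scheduling m n T prec by unfold_locales (rule prec)
  have nT: "n \<le> m * T" by (rule n_le_capacity[OF SA])
  have T: "T \<ge> 1" using nT False by (cases T) auto
  obtain i where i: "2 ^ i \<le> T" "T < 2 ^ Suc i"
    using ex_power_ivl1[of 2 T] T by auto
  define h where "h = Suc i"
  define R where "R = 2 ^ (k * K) * (2 * 2 ^ (k * (2 * K + 1)) * m)"
  have "real (2 ^ i) \<le> real n" using i(1) False by (intro of_nat_mono) simp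
  then have "real i \<le> log 2 n" using T False by (intro le_log_of_power) auto
  then have h: "real h + 1 \<le> log 2 n + 2" by (simp add: h_def)
  then have "Suc h \<le> H" using H by linarith
  then have "h * R + R \<le> r" using r mult_le_mono1[of "Suc h" H R] unfolding R_def by simp
  from feasible_mono[OF window_feasible_trivial[OF SA] this]
  obtain \<sigma> where \<sigma>: "valid (\<lambda>_. 1) (\<lambda>_. T) jobs \<sigma>"
    "K * (2 ^ k * card (discarded jobs \<sigma>)) \<le> 2 ^ k * n + 3 * m * (h + K) * 2 ^ h"
    using schedule_exists[OF k(1) K(2) refl R_def _ T] i(2) unfolding h_def by blast
  let ?d = "real (card (discarded jobs \<sigma>))"
  \<comment> \<open>Pulls out the factor \<open>K\<close> that the averaging divides by, so the
    insertion loss becomes at most \<open>6 * m * (h + 1) * T / 2 ^ k\<close>, using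
    \<open>2 ^ h \<le> 2 * T\<close>.\<close>
  have "K + h \<le> K * (h + 1)" using K(2) by (cases K) auto
  then have "3 * m * (h + K) * 2 ^ h \<le> 3 * m * (K * (h + 1)) * (2 * T)"
    using i(1) by (intro mult_le_mono) (auto simp: h_def)
  then have "K * (2 ^ k * card (discarded jobs \<sigma>)) \<le> 2 ^ k * (m * T) + 3 * m * (K * (h + 1)) * (2 * T)"
    using \<sigma>(2) mult_le_mono2[OF nT, of "2 ^ k"] by linarith
  then have "real (K * (2 ^ k * card (discarded jobs \<sigma>))) \<le>
      real (2 ^ k * (m * T) + 3 * m * (K * (h + 1)) * (2 * T))" by (rule of_nat_mono)
  then have "real K * 2 ^ k * ?d \<le> 2 ^ k * (real m * real T) + real K * (6 * real m * (real h + 1)) * real T"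
    by (simp add: algebra_simps)
  also have "\<dots> \<le> 2 ^ k * (real K * \<epsilon> / 2 * real T) + real K * (2 ^ k * \<epsilon> / 2) * real T"
  proof (intro add_mono mult_left_mono mult_right_mono)
    show "real m \<le> real K * \<epsilon> / 2" using K(1) \<epsilon> by (simp add: field_simps)
    have "6 * real m * (real h + 1) \<le> 6 * real m * (log 2 n + 2)" using h by (intro mult_left_mono) auto
    also have "\<dots> \<le> 2 ^ k * \<epsilon> / 2" using k(2) \<epsilon> by (simp add: field_simps)
    finally show "6 * real m * (real h + 1) \<le> 2 ^ k * \<epsilon> / 2" .
  qed auto
  also have "\<dots> = real K * 2 ^ k * (\<epsilon> * real T)" by (simp add: algebra_simps)
  finally have "?d \<le> \<epsilon> * real T" using K(2) by (simp add: mult_le_cancel_left)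
  moreover have "partial_feasible_schedule m n prec T \<sigma>"
    using \<sigma>(1) prec_jobs unfolding valid_def partial_feasible_schedule_def
    by (metis (no_types, lifting) atLeastAtMost_iff)
  ultimately show ?thesis by blast
qed

lemma rounds_bigo:
  fixes A e :: real and r :: "nat \<Rightarrow> nat"
  assumes "A > 0" "real p \<le> e" and r: "\<And>n. n \<ge> 1 \<Longrightarrow> real (r n) \<le> A * (log 2 n + 3) ^ p"
  shows "(\<lambda>n. real (r n)) \<in> O(\<lambda>n. ln (real n) powr e)"
proof (rule bigoI)
  show "eventually (\<lambda>n. norm (real (r n)) \<le> A * (1 / ln 2 + 3) ^ p * norm (ln (real n) powr e)) at_top"
    \<comment> \<open>From 3 on \<open>ln n \<ge> 1\<close>, so the additive 3 is absorbed by a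
      constant factor and the exponent may be raised to \<open>e\<close>.\<close>
    using eventually_ge_at_top[of 3]
  proof eventually_elim
    case (elim n)
    have "exp 1 \<le> real n" using exp_le elim by linarith
    then have l: "ln (real n) \<ge> 1" using elim by (simp add: ln_ge_iff)
    have "log 2 n + 3 \<le> (1 / ln 2 + 3) * ln n" using l by (simp add: log_def field_simps)
    moreover have "0 \<le> log 2 n + 3" using elim by (simp add: add_nonneg_nonneg)
    ultimately have "(log 2 n + 3) ^ p \<le> ((1 / ln 2 + 3) * ln n) ^ p" by (rule power_mono)
    also have "\<dots> = (1 / ln 2 + 3) ^ p * ln n powr real p"
      using l by (simp add: power_mult_distrib powr_realpow)
    also have "\<dots> \<le> (1 / ln 2 + 3) ^ p * ln n powr e"
      using l assms(2) by (intro mult_left_mono powr_mono) auto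
    finally have "A * (log 2 n + 3) ^ p \<le> A * ((1 / ln 2 + 3) ^ p * ln n powr e)"
      using assms(1) by (intro mult_left_mono) auto
    then show ?case using r[of n] elim by simp
  qed
qed

theorem theorem2:
  shows "\<exists>c::real. c > 0 \<and>
    (\<forall>(m::nat) (\<epsilon>::real). m \<ge> 1 \<longrightarrow> \<epsilon> > 0 \<longrightarrow>
      (\<exists>r :: nat \<Rightarrow> nat.
        (\<lambda>n. real (r n)) \<in> O(\<lambda>n. ln (real n) powr (c * (real m)\<^sup>2 / \<epsilon>\<^sup>2)) \<and>
        (\<forall>(n::nat) (prec :: nat rel) (T::nat).
          precedence_order n prec \<longrightarrow>
          sherali_adams (time_indexed_vars n T) (time_indexed_lp m n prec T) (r n) \<noteq> {} \<longrightarrow>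
          (\<exists>\<sigma> :: nat \<Rightarrow> nat option.
            partial_feasible_schedule m n prec T \<sigma> \<and>
            real (card {j \<in> {1..n}. \<sigma> j = None}) \<le> \<epsilon> * real T))))"
proof (intro exI[of _ 11] conjI allI impI)
  fix m :: nat and \<epsilon> :: real
  assume m: "m \<ge> 1" and \<epsilon>: "\<epsilon> > 0"
  show "\<exists>r :: nat \<Rightarrow> nat.
        (\<lambda>n. real (r n)) \<in> O(\<lambda>n. ln (real n) powr (11 * (real m)\<^sup>2 / \<epsilon>\<^sup>2)) \<and>
        (\<forall>(n::nat) (prec :: nat rel) (T::nat).
          precedence_order n prec \<longrightarrow>
          sherali_adams (time_indexed_vars n T) (time_indexed_lp m n prec T) (r n) \<noteq> {} \<longrightarrow>
          (\<exists>\<sigma> :: nat \<Rightarrow> nat option.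
            partial_feasible_schedule m n prec T \<sigma> \<and>
            real (card {j \<in> {1..n}. \<sigma> j = None}) \<le> \<epsilon> * real T))"
  proof (cases "real m \<le> \<epsilon>")
    case True
    \<comment> \<open>Here all jobs may be discarded, as
      \<open>n \<le> m * T \<le> \<epsilon> * T\<close>; afterwards \<open>x > 1\<close>.\<close>
    have "partial_feasible_schedule m n prec T (\<lambda>_. None) \<and>
        real (card {j \<in> {1..n}. (None :: nat option) = None}) \<le> \<epsilon> * real T"
      if "sherali_adams (time_indexed_vars n T) (time_indexed_lp m n prec T) 0 \<noteq> {}"
      for n T prec
    proof -
      have "real n \<le> real m * real T" using of_nat_mono[OF n_le_capacity[OF that]] by simp
      also have "\<dots> \<le> \<epsilon> * real T" using True by (intro mult_right_mono) auto
      finally have "real n \<le> \<epsilon> * real T" .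
      moreover have "{j \<in> {1..n}. (None :: nat option) = None} = {1..n}" by auto
      ultimately show ?thesis unfolding partial_feasible_schedule_def by simp
    qed
    then show ?thesis by (intro exI[of _ "\<lambda>_. 0"] conjI allI impI exI[of _ "\<lambda>_. None"]) auto
  next
    case False
    define x where "x = real m / \<epsilon>"
    have x: "x > 1" using False \<epsilon> by (simp add: x_def field_simps)
    define K where "K = nat \<lceil>2 * x\<rceil>"
    have K: "real K \<ge> 2 * x" "real K \<le> 2 * x + 1" "K \<ge> 1" using x unfolding K_def by linarith+
    define L where "L n = log 2 (real n) + 2" for n
    \<comment> \<open>For \<open>n = 0\<close> the value is 2, since
      \<open>log 2 0 = 0\<close>.\<close>
    have L: "L n \<ge> 2" for n by (cases "n = 0") (auto simp: L_def log_def)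
    define k where "k n = (SOME k. k \<ge> 1 \<and> 12 * x * L n \<le> 2 ^ k \<and> 2 ^ k \<le> 2 * (12 * x * L n))" for n
    have "k n \<ge> 1 \<and> 12 * x * L n \<le> 2 ^ k n \<and> 2 ^ k n \<le> 2 * (12 * x * L n)" for n
      unfolding k_def
    proof (rule someI_ex, rule power_scale)
      have "1 * 1 \<le> (12 * x) * L n" using x L[of n] by (intro mult_mono) auto
      then show "1 \<le> 12 * x * L n" by simp
    qed
    then have k: "k n \<ge> 1" "12 * x * L n \<le> 2 ^ k n" "2 ^ k n \<le> 24 * x * L n" for n
      by (auto simp: mult.assoc)
    define H where "H n = nat \<lceil>L n\<rceil>" for n
    have H: "real (H n) \<ge> L n" "real (H n) \<le> L n + 1" for n using L[of n] unfolding H_def by linarith+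
    define r where "r n = H n * (2 ^ (k n * K) * (2 * 2 ^ (k n * (2 * K + 1)) * m))" for n
    have "(\<lambda>n. real (r n)) \<in> O(\<lambda>n. ln (real n) powr (11 * (real m)\<^sup>2 / \<epsilon>\<^sup>2))"
    proof (rule rounds_bigo)
      show "0 < 2 * real m * (24 * x) ^ (3 * K + 1)" using m x by simp
      \<comment> \<open>Origin of the constant 11: \<open>K \<le> 2 * x + 1\<close> gives
        \<open>3 * K + 2 \<le> 6 * x + 5\<close>, and \<open>x > 1\<close>.\<close>
      have "real (3 * K + 2) \<le> 11 * x" using K(2) x by simp
      also have "\<dots> \<le> 11 * x\<^sup>2" using x by (simp add: power2_eq_square)
      also have "\<dots> = 11 * (real m)\<^sup>2 / \<epsilon>\<^sup>2" by (simp add: x_def power_divide)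
      finally show "real (3 * K + 2) \<le> 11 * (real m)\<^sup>2 / \<epsilon>\<^sup>2" .
    next
      fix n :: nat
      \<comment> \<open>Of the \<open>3 * K + 1\<close> factors \<open>2 ^ k n\<close>, the nodes
        processed in one recursion step account for \<open>K\<close> and the chain bound
        \<open>D\<close> for \<open>2 * K + 1\<close>; the depth \<open>H n\<close> adds one more
        logarithm.\<close>
      have pow: "2 ^ (k n * K) * 2 ^ (k n * (2 * K + 1)) = ((2::real) ^ k n) ^ (3 * K + 1)"
        by (simp add: algebra_simps flip: power_add power_mult)
      have "real (r n) = real (H n) * (2 * real m) * (2 ^ k n) ^ (3 * K + 1)"
        unfolding pow[symmetric] r_def by simp
      also have "\<dots> \<le> (L n + 1) * (2 * real m) * (24 * x * (L n + 1)) ^ (3 * K + 1)"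
      proof (intro mult_mono power_mono)
        have "24 * x * L n \<le> 24 * x * (L n + 1)" using x by (intro mult_left_mono) auto
        then show "2 ^ k n \<le> 24 * x * (L n + 1)" using k(3)[of n] by linarith
      qed (use H L[of n] in auto)
      also have "\<dots> = 2 * real m * (24 * x) ^ (3 * K + 1) * (L n + 1) ^ (3 * K + 2)"
      proof -
        have "(L n + 1) ^ (3 * K + 2) = (L n + 1) * (L n + 1) ^ (3 * K + 1)" by simp
        then show ?thesis unfolding power_mult_distrib[of "24 * x"] by (simp only: ac_simps)
      qed
      finally show "real (r n) \<le> 2 * real m * (24 * x) ^ (3 * K + 1) * (log 2 (real n) + 3) ^ (3 * K + 2)"
        by (simp add: L_def add.commute)
    qed
    moreover have "\<exists>\<sigma>. partial_feasible_schedule m n prec T \<sigma> \<and>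
            real (card {j \<in> {1..n}. \<sigma> j = None}) \<le> \<epsilon> * real T"
      if "precedence_order n prec"
        "sherali_adams (time_indexed_vars n T) (time_indexed_lp m n prec T) (r n) \<noteq> {}" for n prec T
    proof (rule schedule_few_discarded[OF that(1) m \<epsilon> _ K(3) k(1) _ _ _ that(2)])
      show "2 * real m / \<epsilon> \<le> real K" using K(1) by (simp add: x_def)
      show "12 * real m * (log 2 (real n) + 2) / \<epsilon> \<le> 2 ^ k n"
        using k(2)[of n] by (simp add: x_def L_def)
      show "log 2 (real n) + 2 \<le> real (H n)" using H(1)[of n] by (simp add: L_def)
      show "H n * (2 ^ (k n * K) * (2 * 2 ^ (k n * (2 * K + 1)) * m)) \<le> r n" by (simp add: r_def)
    qed
    ultimately show ?thesis by blast
  qed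
qed simp

end
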